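(* Let $(M,F)$ be a Finsler surface with nonflat geodesic spray $S$, and let $(H,S,V,\mathcal{C})$ be its Berwald frame. If $V(\rho)=-\mathcal{I}\,\rho$ and $S(\rho)=0$, then $(M,F)$ is Riemannian.
   Context: $M$ is a $2$-dimensional smooth manifold, $\mathcal{T}M$ its tangent bundle with the zero section removed, with induced coordinates $(x^i,y^i)$; $J=\frac{\partial}{\partial y^i}\otimes dx^i$ is the almost-tangent structure and $\mathcal{C}=y^i\frac{\partial}{\partial y^i}$ the Liouville vector field. $F:TM\to\mathbb{R}$ is a Finsler function: smooth and positive on $\mathcal{T}M$, zero exactly on the zero section, positively $1$-homogeneous in $y$, with $g_{ij}=\frac12\frac{\partial^2F^2}{\partial y^i\partial y^j}$ of maximal rank on $\mathcal{T}M$. $S=y^i\frac{\partial}{\partial x^i}-2G^i\frac{\partial}{\partial y^i}$ is its geodesic spray, and "horizontal" refers to the image of the projector $h=\frac12(Id+[J,S])$ (Frölicher–Nijenhuis bracket). With $G^i_j=\partial G^i/\partial y^j$, the Jacobi endomorphism is $\Phi=\big(2\frac{\partial G^i}{\partial x^j}-S(G^i_j)-G^i_kG^k_j\big)\frac{\partial}{\partial y^i}\otimes dx^j$; in dimension $2$ one has $\Phi=K(F^2J-F\,d_JF\otimes\mathcal{C})$, where $K\in C^\infty(\mathcal{T}M)$ is the flag curvature; the Ricci scalar is $\rho=KF^2$. $S$ is nonflat: $K$ vanishes nowhere on $\mathcal{T}M$. Berwald frame: $H$ is a horizontal vector field on $\mathcal{T}M$ with $[\mathcal{C},H]=H$,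 $d_JF(H)=0$, $V:=JH$, normalized so that $[S,H]=\rho V$, $[V,S]=H$, $[H,V]=S+\mathcal{I}H+\mathcal{J}V$ with $\mathcal{J}=S(\mathcal{I})$. Here $\mathcal{I}$ is the main (Cartan) scalar and $\mathcal{J}$ the Landsberg scalar. $H,S,V$ annihilate $F$ (so $V(\rho)=-\mathcal{I}\rho$ is equivalent to $V(K)=-\mathcal{I}K$, and $S(\rho)=0$ to $S(K)=0$). $(M,F)$ is Riemannian when $F^2$ is a quadratic form in $y$, equivalently $\mathcal{I}=0$. *)

theory Defs
  imports "HOL-Analysis.Analysis"
begin

section \<open>Smooth maps on open sets\<close>

primrec Ck_on :: "nat \<Rightarrow> 'e::real_normed_vector set \<Rightarrow> ('e \<Rightarrow> 'b::real_normed_vector) \<Rightarrow> bool" where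
  "Ck_on 0 X f = continuous_on X f"
| "Ck_on (Suc k) X f =
     ((\<forall>x\<in>X. f differentiable (at x)) \<and> (\<forall>v. Ck_on k X (\<lambda>x. frechet_derivative f (at x) v)))"

definition smooth_on :: "'e::real_normed_vector set \<Rightarrow> ('e \<Rightarrow> 'b::real_normed_vector) \<Rightarrow> bool" where
  "smooth_on X f \<longleftrightarrow> (\<forall>k. Ck_on k X f)"

section \<open>Manifolds, tangent vectors and vector fields\<close>

text \<open>A chart is a domain together with a coordinate map (relevant on the domain only);
  an atlas is a set of charts.  The dimension is that of the model space.\<close>

type_synonym ('p, 'e) chart = "'p set \<times> ('p \<Rightarrow> 'e)"

definition cinv :: "('p, 'e) chart \<Rightarrow> 'e \<Rightarrow> 'p" where
  "cinv c = inv_into (fst c) (snd c)"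

definition cimage :: "('p, 'e) chart \<Rightarrow> 'e set" where
  "cimage c = snd c ` fst c"

definition points :: "('p, 'e) chart set \<Rightarrow> 'p set" where
  "points A = (\<Union>c\<in>A. fst c)"

definition smooth_manifold :: "'p topology \<Rightarrow> ('p, 'e::euclidean_space) chart set \<Rightarrow> bool" where
  "smooth_manifold M A \<longleftrightarrow>
     Hausdorff_space M \<and> second_countable M \<and> points A = topspace M \<and>
     (\<forall>c\<in>A. openin M (fst c) \<and> open (cimage c) \<and>
        homeomorphic_map (subtopology M (fst c)) (top_of_set (cimage c)) (snd c)) \<and>
     (\<forall>c\<in>A. \<forall>d\<in>A. smooth_on (snd c ` (fst c \<inter> fst d)) (snd d \<circ> cinv c))"

text \<open>A tangent vector at \<open>q\<close> is the family of its components in all charts around \<open>q\<close>,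
  transforming by the derivative of the coordinate changes.  Components with respect to
  irrelevant charts are set to zero, so that equality of tangent vectors is equality of functions.\<close>

type_synonym ('p, 'e) comps = "('p, 'e) chart \<Rightarrow> 'e"

type_synonym ('p, 'e) tvec = "'p \<times> ('p, 'e) comps"

definition tangent_space :: "('p, 'e::euclidean_space) chart set \<Rightarrow> 'p \<Rightarrow> ('p, 'e) comps set" where
  "tangent_space A q =
     {w. (\<forall>c\<in>A. \<forall>d\<in>A. q \<in> fst c \<inter> fst d \<longrightarrow>
            w d = frechet_derivative (snd d \<circ> cinv c) (at (snd c q)) (w c)) \<and>
         (\<forall>c. \<not> (c \<in> A \<and> q \<in> fst c) \<longrightarrow> w c = 0)}"

definition tangent_bundle :: "('p, 'e::euclidean_space) chart set \<Rightarrow> ('p, 'e) tvec set" where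
  "tangent_bundle A = {(p, v). p \<in> points A \<and> v \<in> tangent_space A p}"

definition smooth_function :: "('p, 'e::euclidean_space) chart set \<Rightarrow> ('p \<Rightarrow> real) \<Rightarrow> bool" where
  "smooth_function A f \<longleftrightarrow> (\<forall>c\<in>A. smooth_on (cimage c) (f \<circ> cinv c))"

text \<open>The derivative of \<open>f\<close> at \<open>q\<close> along a tangent vector, computed in any chart around \<open>q\<close>.\<close>

definition directional :: "('p, 'e::euclidean_space) chart set \<Rightarrow> ('p \<Rightarrow> real) \<Rightarrow> 'p \<Rightarrow> ('p, 'e) comps \<Rightarrow> real" where
  "directional A f q w =
     (let c = (SOME c. c \<in> A \<and> q \<in> fst c)
      in frechet_derivative (f \<circ> cinv c) (at (snd c q)) (w c))"

type_synonym ('p, 'e) vfield = "'p \<Rightarrow> ('p, 'e) comps"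

definition local_rep :: "('p, 'e) vfield \<Rightarrow> ('p, 'e) chart \<Rightarrow> 'e \<Rightarrow> 'e" where
  "local_rep X c z = X (cinv c z) c"

definition vector_field :: "('p, 'e::euclidean_space) chart set \<Rightarrow> ('p, 'e) vfield \<Rightarrow> bool" where
  "vector_field A X \<longleftrightarrow>
     (\<forall>q\<in>points A. X q \<in> tangent_space A q) \<and> (\<forall>c\<in>A. smooth_on (cimage c) (local_rep X c))"

definition vf_apply :: "('p, 'e::euclidean_space) chart set \<Rightarrow> ('p, 'e) vfield \<Rightarrow> ('p \<Rightarrow> real) \<Rightarrow> 'p \<Rightarrow> real" where
  "vf_apply A X f q = directional A f q (X q)"

text \<open>The field with given component functions in each chart.\<close>

definition field_of_comps ::
  "('p, 'e::euclidean_space) chart set \<Rightarrow> (('p, 'e) chart \<Rightarrow> 'e \<Rightarrow> 'e) \<Rightarrow> ('p, 'e) vfield" where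
  "field_of_comps A \<omega> q c = (if c \<in> A \<and> q \<in> fst c then \<omega> c (snd c q) else 0)"

text \<open>In coordinates, \<open>[X,Y]\<^sup>a = X(Y\<^sup>a) - Y(X\<^sup>a)\<close>.\<close>

definition lie_bracket ::
  "('p, 'e::euclidean_space) chart set \<Rightarrow> ('p, 'e) vfield \<Rightarrow> ('p, 'e) vfield \<Rightarrow> ('p, 'e) vfield" where
  "lie_bracket A X Y = field_of_comps A (\<lambda>c z.
     frechet_derivative (local_rep Y c) (at z) (local_rep X c z) -
     frechet_derivative (local_rep X c) (at z) (local_rep Y c z))"

section \<open>The slit tangent bundle of a surface\<close>

definition slit :: "('p, 'e::euclidean_space) chart set \<Rightarrow> ('p, 'e) tvec set" where
  "slit A = {u \<in> tangent_bundle A. snd u \<noteq> (\<lambda>_. 0)}"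

text \<open>The atlas of the slit tangent bundle given by the induced coordinates \<open>(x, y)\<close>.  Vector
  fields on the slit tangent bundle are vector fields for this atlas; their components are pairs
  \<open>(\<xi>, \<eta>)\<close> standing for \<open>\<xi>\<^sup>i \<partial>/\<partial>x\<^sup>i + \<eta>\<^sup>i \<partial>/\<partial>y\<^sup>i\<close>.\<close>

definition slit_atlas :: "('p, 'e::euclidean_space) chart set \<Rightarrow> (('p, 'e) tvec, 'e \<times> 'e) chart set" where
  "slit_atlas A = (\<lambda>c. ({u \<in> slit A. fst u \<in> fst c}, \<lambda>u. (snd c (fst u), snd u c))) ` A"

text \<open>The almost-tangent structure acting on one tangent vector, and the Liouville field.\<close>

definition vert_J :: "('q, 'e::euclidean_space \<times> 'e) comps \<Rightarrow> ('q, 'e \<times> 'e) comps" where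
  "vert_J w = (\<lambda>c. (0, fst (w c)))"

definition liouville :: "('p, 'e::euclidean_space) chart set \<Rightarrow> (('p, 'e) tvec, 'e \<times> 'e) vfield" where
  "liouville A = field_of_comps (slit_atlas A) (\<lambda>c z. (0, snd z))"

type_synonym 'p satlas = "('p, real^2) chart set"
type_synonym 'p stvec = "('p, real^2) tvec"
type_synonym 'p slit_chart = "('p stvec, (real^2) \<times> (real^2)) chart"
type_synonym 'p slit_comps = "('p stvec, (real^2) \<times> (real^2)) comps"
type_synonym 'p slit_field = "('p stvec, (real^2) \<times> (real^2)) vfield"

definition dx :: "2 \<Rightarrow> ((real^2) \<times> (real^2) \<Rightarrow> real) \<Rightarrow> (real^2) \<times> (real^2) \<Rightarrow> real" where
  "dx i f z = frechet_derivative f (at z) (axis i 1, 0)"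

definition dy :: "2 \<Rightarrow> ((real^2) \<times> (real^2) \<Rightarrow> real) \<Rightarrow> (real^2) \<times> (real^2) \<Rightarrow> real" where
  "dy i f z = frechet_derivative f (at z) (0, axis i 1)"

section \<open>Finsler functions and the geodesic spray\<close>

text \<open>\<open>F\<^sup>2\<close> and the metric tensor \<open>g\<^sub>i\<^sub>j\<close> in induced coordinates.\<close>

definition Fsq :: "('p stvec \<Rightarrow> real) \<Rightarrow> 'p slit_chart \<Rightarrow> (real^2) \<times> (real^2) \<Rightarrow> real" where
  "Fsq F c z = (F (cinv c z))\<^sup>2"

definition metric :: "('p stvec \<Rightarrow> real) \<Rightarrow> 'p slit_chart \<Rightarrow> (real^2) \<times> (real^2) \<Rightarrow> real^2^2" where
  "metric F c z = (\<chi> i j. (1/2) * dy i (dy j (Fsq F c)) z)"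

definition finsler_function :: "'p satlas \<Rightarrow> ('p stvec \<Rightarrow> real) \<Rightarrow> bool" where
  "finsler_function A F \<longleftrightarrow>
     smooth_function (slit_atlas A) F \<and>
     (\<forall>u\<in>slit A. F u > 0) \<and>
     (\<forall>u\<in>tangent_bundle A. F u = 0 \<longleftrightarrow> snd u = (\<lambda>_. 0)) \<and>
     (\<forall>(p, v)\<in>tangent_bundle A. \<forall>t>0. F (p, \<lambda>c. t *\<^sub>R v c) = t * F (p, v)) \<and>
     (\<forall>c\<in>slit_atlas A. \<forall>z\<in>cimage c. rank (metric F c z) = 2)"

text \<open>Coefficients of the geodesic spray:
  \<open>G\<^sup>i = \<onequarter> g\<^sup>i\<^sup>j (y\<^sup>k \<partial>\<^sup>2F\<^sup>2/\<partial>x\<^sup>k\<partial>y\<^sup>j - \<partial>F\<^sup>2/\<partial>x\<^sup>j)\<close>, that is, the solution of the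
  Euler-Lagrange equations \<open>S(\<partial>F\<^sup>2/\<partial>y\<^sup>j) = \<partial>F\<^sup>2/\<partial>x\<^sup>j\<close>, equivalently of \<open>i\<^sub>S dd\<^sub>J F\<^sup>2 = - dF\<^sup>2\<close>.\<close>

definition spray_coeff :: "('p stvec \<Rightarrow> real) \<Rightarrow> 'p slit_chart \<Rightarrow> (real^2) \<times> (real^2) \<Rightarrow> real^2" where
  "spray_coeff F c z = (1/4) *\<^sub>R (matrix_inv (metric F c z) *v
     (\<chi> j. (\<Sum>k\<in>UNIV. (snd z $ k) * dx k (dy j (Fsq F c)) z) - dx j (Fsq F c) z))"

definition spray_comps ::
  "('p stvec \<Rightarrow> real) \<Rightarrow> 'p slit_chart \<Rightarrow> (real^2) \<times> (real^2) \<Rightarrow> (real^2) \<times> (real^2)" where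
  "spray_comps F c z = (snd z, - 2 *\<^sub>R spray_coeff F c z)"

definition geodesic_spray :: "'p satlas \<Rightarrow> ('p stvec \<Rightarrow> real) \<Rightarrow> 'p slit_field" where
  "geodesic_spray A F = field_of_comps (slit_atlas A) (spray_comps F)"

text \<open>The horizontal projector \<open>h = \<onehalf>(Id + [J,S])\<close>, where the Froelicher-Nijenhuis bracket
  is \<open>[J,S](X) = [JX,S] - J[X,S]\<close>.\<close>

definition hor_proj :: "'p satlas \<Rightarrow> ('p stvec \<Rightarrow> real) \<Rightarrow> 'p slit_field \<Rightarrow> 'p slit_field" where
  "hor_proj A F X = (\<lambda>u c. (1/2) *\<^sub>R (X u c +
     (lie_bracket (slit_atlas A) (\<lambda>u'. vert_J (X u')) (geodesic_spray A F) u c -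
      vert_J (lie_bracket (slit_atlas A) X (geodesic_spray A F) u) c)))"

definition horizontal :: "'p satlas \<Rightarrow> ('p stvec \<Rightarrow> real) \<Rightarrow> 'p slit_field \<Rightarrow> bool" where
  "horizontal A F H \<longleftrightarrow>
     (\<exists>X. vector_field (slit_atlas A) X \<and> (\<forall>u\<in>slit A. H u = hor_proj A F X u))"

section \<open>Curvature\<close>

definition spray_conn ::
  "('p stvec \<Rightarrow> real) \<Rightarrow> 'p slit_chart \<Rightarrow> 2 \<Rightarrow> 2 \<Rightarrow> (real^2) \<times> (real^2) \<Rightarrow> real" where
  "spray_conn F c i j = dy j (\<lambda>z. spray_coeff F c z $ i)"

definition jacobi_matrix :: "('p stvec \<Rightarrow> real) \<Rightarrow> 'p slit_chart \<Rightarrow> (real^2) \<times> (real^2) \<Rightarrow> real^2^2" where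
  "jacobi_matrix F c z = (\<chi> i j.
     2 * dx j (\<lambda>z'. spray_coeff F c z' $ i) z
     - frechet_derivative (spray_conn F c i j) (at z) (spray_comps F c z)
     - (\<Sum>k\<in>UNIV. spray_conn F c i k z * spray_conn F c k j z))"

text \<open>The Jacobi endomorphism at \<open>u\<close>, acting on a vector tangent to the slit tangent bundle.\<close>

definition jacobi_endo :: "'p satlas \<Rightarrow> ('p stvec \<Rightarrow> real) \<Rightarrow> 'p stvec \<Rightarrow> 'p slit_comps \<Rightarrow> 'p slit_comps" where
  "jacobi_endo A F u w = (\<lambda>c. if c \<in> slit_atlas A \<and> u \<in> fst c
     then (0, jacobi_matrix F c (snd c u) *v fst (w c)) else 0)"

definition d_J :: "'p satlas \<Rightarrow> ('p stvec \<Rightarrow> real) \<Rightarrow> 'p stvec \<Rightarrow> 'p slit_comps \<Rightarrow> real" where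
  "d_J A f u w = directional (slit_atlas A) f u (vert_J w)"

text \<open>\<open>K\<close> is the flag curvature: \<open>\<Phi> = K (F\<^sup>2 J - F d\<^sub>JF \<otimes> C)\<close>.\<close>

definition flag_curvature :: "'p satlas \<Rightarrow> ('p stvec \<Rightarrow> real) \<Rightarrow> ('p stvec \<Rightarrow> real) \<Rightarrow> bool" where
  "flag_curvature A F K \<longleftrightarrow> smooth_function (slit_atlas A) K \<and>
     (\<forall>u\<in>slit A. \<forall>w\<in>tangent_space (slit_atlas A) u. \<forall>c.
        jacobi_endo A F u w c =
          K u *\<^sub>R ((F u)\<^sup>2 *\<^sub>R vert_J w c - (F u * d_J A F u w) *\<^sub>R liouville A u c))"

definition ricci_scalar :: "('p stvec \<Rightarrow> real) \<Rightarrow> ('p stvec \<Rightarrow> real) \<Rightarrow> 'p stvec \<Rightarrow> real" where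
  "ricci_scalar F K u = K u * (F u)\<^sup>2"

section \<open>Berwald frame, Riemannian metrics\<close>

text \<open>\<open>(H, S, V, C)\<close> is a Berwald frame with main scalar \<open>I\<close>, where \<open>S\<close> is the geodesic spray,
  \<open>C\<close> the Liouville field and \<open>K\<close> the flag curvature; the Landsberg scalar is \<open>S(I)\<close>.\<close>

definition berwald_frame ::
  "'p satlas \<Rightarrow> ('p stvec \<Rightarrow> real) \<Rightarrow> ('p stvec \<Rightarrow> real) \<Rightarrow>
   'p slit_field \<Rightarrow> 'p slit_field \<Rightarrow> ('p stvec \<Rightarrow> real) \<Rightarrow> bool" where
  "berwald_frame A F K H V I \<longleftrightarrow>
     (let B = slit_atlas A; S = geodesic_spray A F; \<rho> = ricci_scalar F K in
      vector_field B H \<and> horizontal A F H \<and>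
      (\<forall>u\<in>slit A. lie_bracket B (liouville A) H u = H u) \<and>
      (\<forall>u\<in>slit A. d_J A F u (H u) = 0) \<and>
      V = (\<lambda>u. vert_J (H u)) \<and>
      smooth_function B I \<and>
      (\<forall>u\<in>slit A. \<forall>c. lie_bracket B S H u c = \<rho> u *\<^sub>R V u c) \<and>
      (\<forall>u\<in>slit A. lie_bracket B V S u = H u) \<and>
      (\<forall>u\<in>slit A. \<forall>c. lie_bracket B H V u c =
         S u c + I u *\<^sub>R H u c + vf_apply B S I u *\<^sub>R V u c))"

text \<open>\<open>F\<^sup>2\<close> restricts to a quadratic form on each tangent space.\<close>

definition riemannian :: "'p satlas \<Rightarrow> ('p stvec \<Rightarrow> real) \<Rightarrow> bool" where
  "riemannian A F \<longleftrightarrow>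
     (\<forall>c\<in>A. \<forall>p\<in>fst c. \<exists>a::real^2^2. transpose a = a \<and>
        (\<forall>v\<in>tangent_space A p. (F (p, v))\<^sup>2 = v c \<bullet> (a *v v c)))"

end

theory Submission
  imports Defs
begin

text \<open>
  The proof has two parts.

  First, the main scalar \<open>I\<close> vanishes. The two hypotheses on \<open>\<rho>\<close> prescribe \<open>V(\<rho>)\<close> and \<open>S(\<rho>)\<close>, and
  \<open>[V,S] = H\<close> then gives \<open>H(\<rho>) = S(I) \<rho>\<close>. The bracket \<open>[S,H] = \<rho> V\<close>, applied to \<open>\<rho>\<close>, yields
  \<open>S(S(I)) = - I \<rho>\<close>, while the Jacobi identity for \<open>S, H, V\<close> is the Bianchi identity
  \<open>S(S(I)) + V(\<rho>) + I \<rho> = 0\<close>, so that \<open>S(S(I)) = 0\<close>. Hence \<open>I \<rho> = 0\<close>, and \<open>I = 0\<close> because \<open>\<rho> = K F\<^sup>2\<close>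
  has no zeros. In the lemma \<open>main_scalar_times_curvature_eq_0\<close> the Jacobi identity is used
  only through the action of the three fields on the single function \<open>\<rho>\<close> and its derivatives, where it
  takes the form \<open>(V(\<rho>))\<^sup>2 = 0\<close>. All that is needed about brackets is therefore that \<open>[X,Y](f)\<close> is
  \<open>X(Y(f)) - Y(X(f))\<close>, the lemma \<open>field_deriv_bracket\<close>, which rests on the symmetry of second derivatives.

  Second, \<open>I = 0\<close> makes \<open>F\<^sup>2\<close> quadratic on each tangent plane. Write \<open>H = (\<xi>, \<eta>)\<close> in induced coordinates,
  so \<open>V = (0, \<xi>)\<close>. The first component of \<open>[H,V] = S + S(I) V\<close> reads \<open>V(\<xi>) = - y\<close>, and \<open>V(F\<^sup>2) = 0\<close>. Thus
  the field \<open>\<xi>\<close> on the punctured tangent plane is tangent to the indicatrices and moves along them by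
  \<open>y' = \<xi>\<close>, \<open>\<xi>' = - y\<close>, which are the equations of an ellipse. The lemma
  \<open>quadratic_if_rotating_tangent_field\<close> turns this into the vanishing of all third derivatives
  of \<open>F\<^sup>2\<close> in \<open>y\<close>, that is, of the Cartan tensor.

  The remaining work is the passage between the slit tangent bundle and its charts. The fields \<open>H\<close> and \<open>V\<close>
  are genuine vector fields, so their action on functions is the same in all charts. For the spray, which is
  defined chart by chart, this follows from \<open>[H,V] = S + I H + S(I) V\<close>, see
  \<open>bracket_combination_in_chart\<close>, in place of the transformation law of the spray coefficients.
\<close>

section \<open>Maps of class \<open>C\<^sup>k\<close> on open sets\<close>

lemma differentiable_transform_open:
  assumes "f differentiable (at x)" "open X" "x \<in> X" "\<And>y. y \<in> X \<Longrightarrow> f y = g y"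
  shows "g differentiable (at x)"
  using assms has_derivative_transform_within_open unfolding differentiable_def by metis

lemma Ck_on_cong:
  assumes "open X" "\<And>x. x \<in> X \<Longrightarrow> f x = g x" "Ck_on k X f"
  shows "Ck_on k X g"
  using assms(2,3)
proof (induction k arbitrary: f g)
  case 0
  then show ?case by (simp add: continuous_on_eq)
next
  case (Suc k)
  have d: "frechet_derivative f (at x) = frechet_derivative g (at x)" if "x \<in> X" for x
    by (rule frechet_derivative_transform_within_open[OF _ assms(1) that]) (use that Suc.prems in auto)
  have "g differentiable (at x)" if "x \<in> X" for x
    by (rule differentiable_transform_open[OF _ assms(1) that, of f g]) (use that Suc.prems in auto)
  moreover have "Ck_on k X (\<lambda>x. frechet_derivative g (at x) v)" for v
    by (rule Suc.IH[of "\<lambda>x. frechet_derivative f (at x) v"]) (use Suc.prems in \<open>simp_all add: d\<close>)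
  ultimately show ?case by simp
qed

lemma Ck_on_Suc_imp_Ck_on: "Ck_on (Suc k) X f \<Longrightarrow> Ck_on k X f"
proof (induction k arbitrary: f)
  case 0
  then show ?case
    by (auto intro!: continuous_at_imp_continuous_on differentiable_imp_continuous_within)
next
  case (Suc k)
  then show ?case by auto
qed

lemma Ck_on_const: "Ck_on k X (\<lambda>x. c)"
proof (induction k arbitrary: c)
  case (Suc k)
  then show ?case by simp
qed simp

text \<open>To climb from class \<open>k\<close> to \<open>k + 1\<close> it is enough to have the derivative in closed
  form on the open set, where it agrees with the chosen one; each closure property below is then one
  differentiation rule and the induction hypothesis.\<close>

lemma Ck_on_SucI:
  assumes "open X" "\<And>x. x \<in> X \<Longrightarrow> (f has_derivative f' x) (at x)"
    and "\<And>v. Ck_on k X (\<lambda>x. f' x v)"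
  shows "Ck_on (Suc k) X f"
proof -
  have "frechet_derivative f (at x) = f' x" if "x \<in> X" for x
    using assms(2)[OF that] by (rule frechet_derivative_at[symmetric])
  then have "Ck_on k X (\<lambda>x. frechet_derivative f (at x) v)" for v
    by (intro Ck_on_cong[OF assms(1) _ assms(3)[of v]]) auto
  then show ?thesis
    using assms(2) by (auto simp: differentiable_def)
qed

lemma Ck_on_SucD:
  assumes "Ck_on (Suc k) X f"
  shows "x \<in> X \<Longrightarrow> (f has_derivative frechet_derivative f (at x)) (at x)"
    and "Ck_on k X (\<lambda>x. frechet_derivative f (at x) v)"
  using assms by (auto simp: frechet_derivative_works)

lemma Ck_on_add:
  assumes "open X"
  shows "Ck_on k X f \<Longrightarrow> Ck_on k X g \<Longrightarrow> Ck_on k X (\<lambda>x. f x + g x)"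
proof (induction k arbitrary: f g)
  case (Suc k)
  show ?case
  proof (rule Ck_on_SucI[OF assms])
    show "((\<lambda>x. f x + g x) has_derivative
        (\<lambda>v. frechet_derivative f (at x) v + frechet_derivative g (at x) v)) (at x)" if "x \<in> X" for x
      using that Suc.prems by (blast intro: has_derivative_add Ck_on_SucD)
    show "Ck_on k X (\<lambda>x. frechet_derivative f (at x) v + frechet_derivative g (at x) v)" for v
      by (rule Suc.IH; rule Ck_on_SucD; fact)
  qed
qed (auto intro: continuous_intros)

lemma Ck_on_sum:
  assumes "open X" "\<And>i. i \<in> B \<Longrightarrow> Ck_on k X (f i)"
  shows "Ck_on k X (\<lambda>x. \<Sum>i\<in>B. f i x)"
  using assms(2)
proof (induction B rule: infinite_finite_induct)
  case (insert i B)
  then show ?case by (auto intro!: Ck_on_add assms(1))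
qed (simp_all add: Ck_on_const)

lemma Ck_on_bilinear:
  assumes "open X" and h: "bounded_bilinear h"
  shows "Ck_on k X f \<Longrightarrow> Ck_on k X g \<Longrightarrow> Ck_on k X (\<lambda>x. h (f x) (g x))"
proof (induction k arbitrary: f g)
  case 0
  then show ?case using bounded_bilinear.continuous_on[OF h] by simp
next
  case (Suc k)
  note d = Suc.prems[THEN Ck_on_SucD(1)] Suc.prems[THEN Ck_on_SucD(2)] Suc.prems[THEN Ck_on_Suc_imp_Ck_on]
  show ?case
  proof (rule Ck_on_SucI[OF assms(1)])
    show "((\<lambda>x. h (f x) (g x)) has_derivative (\<lambda>v. h (f x) (frechet_derivative g (at x) v) +
        h (frechet_derivative f (at x) v) (g x))) (at x)" if "x \<in> X" for x
      using bounded_bilinear.FDERIV[OF h d(1,2)[OF that]] .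
    show "Ck_on k X (\<lambda>x. h (f x) (frechet_derivative g (at x) v) +
        h (frechet_derivative f (at x) v) (g x))" for v
      using Ck_on_add[OF assms(1) Suc.IH[OF d(5,4)] Suc.IH[OF d(3,6)]] .
  qed
qed

lemma Ck_on_linear:
  assumes "open X" and h: "bounded_linear h"
  shows "Ck_on k X f \<Longrightarrow> Ck_on k X (\<lambda>x. h (f x))"
proof (induction k arbitrary: f)
  case 0
  then show ?case using bounded_linear.continuous_on[OF h] by simp
next
  case (Suc k)
  note d = Ck_on_SucD[OF Suc.prems]
  show ?case
    by (rule Ck_on_SucI[OF assms(1) bounded_linear.has_derivative[OF h d(1)] Suc.IH[OF d(2)]])
qed

text \<open>An inner map with constant derivative \<open>l\<close> turns the derivative of \<open>f\<close> in direction \<open>l v\<close> into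
  that of the composite in direction \<open>v\<close>, so the induction needs no product rule. The application is
  the restriction of a function on the tangent bundle to one fibre \<open>y \<mapsto> (x, y)\<close>.\<close>

lemma Ck_on_affine_comp:
  assumes "open X" "open Y" and g: "\<And>y. (g has_derivative l) (at y)"
    and "\<And>y. y \<in> Y \<Longrightarrow> g y \<in> X"
  shows "Ck_on k X f \<Longrightarrow> Ck_on k Y (\<lambda>y. f (g y))"
proof (induction k arbitrary: f)
  case 0
  have "continuous_on Y g"
    by (intro continuous_at_imp_continuous_on ballI has_derivative_continuous[OF g])
  then show ?case using 0 assms(4) by (auto intro: continuous_on_compose2)
next
  case (Suc k)
  note d = Ck_on_SucD[OF Suc.prems]
  show ?case
    by (rule Ck_on_SucI[OF assms(2) has_derivative_compose[OF g d(1)[OF assms(4)]] Suc.IH[OF d(2)]])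
qed

lemma smooth_on_differentiable: "smooth_on X f \<Longrightarrow> x \<in> X \<Longrightarrow> f differentiable (at x)"
  unfolding smooth_on_def by (metis Ck_on.simps(2))

lemma smooth_on_has_derivative:
  "smooth_on X f \<Longrightarrow> x \<in> X \<Longrightarrow> (f has_derivative frechet_derivative f (at x)) (at x)"
  using smooth_on_differentiable frechet_derivative_works by blast

lemma smooth_on_frechet_derivative:
  "smooth_on X f \<Longrightarrow> smooth_on X (\<lambda>x. frechet_derivative f (at x) v)"
  unfolding smooth_on_def by (metis Ck_on.simps(2))

lemma smooth_on_cong:
  "open X \<Longrightarrow> (\<And>x. x \<in> X \<Longrightarrow> f x = g x) \<Longrightarrow> smooth_on X f \<Longrightarrow> smooth_on X g"
  unfolding smooth_on_def using Ck_on_cong by blast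

lemma smooth_on_sum:
  "open X \<Longrightarrow> (\<And>i. i \<in> B \<Longrightarrow> smooth_on X (f i)) \<Longrightarrow> smooth_on X (\<lambda>x. \<Sum>i\<in>B. f i x)"
  by (simp add: smooth_on_def Ck_on_sum)

lemma smooth_on_mult:
  fixes f g :: "'a::real_normed_vector \<Rightarrow> real"
  shows "open X \<Longrightarrow> smooth_on X f \<Longrightarrow> smooth_on X g \<Longrightarrow> smooth_on X (\<lambda>x. f x * g x)"
  by (simp add: smooth_on_def Ck_on_bilinear[OF _ bounded_bilinear_mult])

lemma smooth_on_linear:
  "open X \<Longrightarrow> bounded_linear h \<Longrightarrow> smooth_on X f \<Longrightarrow> smooth_on X (\<lambda>x. h (f x))"
  by (simp add: smooth_on_def Ck_on_linear)

lemma smooth_on_affine_comp: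
  assumes "open X" "open Y" "\<And>y. (g has_derivative l) (at y)" "\<And>y. y \<in> Y \<Longrightarrow> g y \<in> X" "smooth_on X f"
  shows "smooth_on Y (\<lambda>y. f (g y))"
  unfolding smooth_on_def
proof
  show "Ck_on k Y (\<lambda>y. f (g y))" for k
    using assms(5) by (intro Ck_on_affine_comp[OF assms(1-4), where f = f]) (simp_all add: smooth_on_def)
qed

lemma linear_expand_Basis:
  assumes "linear l"
  shows "l w = (\<Sum>b\<in>Basis. (w \<bullet> b) *\<^sub>R l b)"
proof -
  have "l w = l (\<Sum>b\<in>Basis. (w \<bullet> b) *\<^sub>R b)"
    by (simp add: euclidean_representation)
  also have "\<dots> = (\<Sum>b\<in>Basis. (w \<bullet> b) *\<^sub>R l b)"
    by (simp add: linear_sum[OF assms] linear_scale[OF assms])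
  finally show ?thesis .
qed

section \<open>Vector fields as derivations\<close>

definition field_deriv :: "('e::real_normed_vector \<Rightarrow> 'e) \<Rightarrow> ('e \<Rightarrow> 'b::real_normed_vector) \<Rightarrow> 'e \<Rightarrow> 'b" where
  "field_deriv X f z = frechet_derivative f (at z) (X z)"

definition field_bracket :: "('e::real_normed_vector \<Rightarrow> 'e) \<Rightarrow> ('e \<Rightarrow> 'e) \<Rightarrow> 'e \<Rightarrow> 'e" where
  "field_bracket X Y z = frechet_derivative Y (at z) (X z) - frechet_derivative X (at z) (Y z)"

lemma field_deriv_cong:
  assumes "open U" "z \<in> U" "\<And>x. x \<in> U \<Longrightarrow> f x = g x"
    and "f differentiable (at z)"
  shows "field_deriv X f z = field_deriv X g z"
  unfolding field_deriv_def
  using frechet_derivative_transform_within_open[OF assms(4,1,2)] assms(3) by simp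

lemma field_deriv_mult:
  fixes f g :: "'e::real_normed_vector \<Rightarrow> real"
  assumes "f differentiable (at z)" "g differentiable (at z)"
  shows "field_deriv X (\<lambda>x. f x * g x) z = field_deriv X f z * g z + f z * field_deriv X g z"
proof -
  have "((\<lambda>x. f x * g x) has_derivative
    (\<lambda>v. f z * frechet_derivative g (at z) v + frechet_derivative f (at z) v * g z)) (at z)"
    using assms by (intro has_derivative_mult) (simp_all add: frechet_derivative_works[symmetric])
  from frechet_derivative_at[OF this] show ?thesis
    by (simp add: field_deriv_def fun_eq_iff) (metis add.commute)
qed

lemma field_deriv_expand:
  assumes "f differentiable (at z)"
  shows "field_deriv X f z = (\<Sum>b\<in>Basis. (X z \<bullet> b) *\<^sub>R frechet_derivative f (at z) b)"
  unfolding field_deriv_def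
  by (rule linear_expand_Basis) (use assms linear_frechet_derivative in blast)

lemma smooth_on_field_deriv:
  fixes f :: "'e::euclidean_space \<Rightarrow> real"
  assumes "open U" "smooth_on U X" "smooth_on U f"
  shows "smooth_on U (field_deriv X f)"
proof (rule smooth_on_cong[OF assms(1)])
  show "smooth_on U (\<lambda>z. \<Sum>b\<in>Basis. (X z \<bullet> b) * frechet_derivative f (at z) b)"
    by (intro smooth_on_sum smooth_on_mult smooth_on_frechet_derivative
        smooth_on_linear[OF _ bounded_linear_inner_left] assms)
next
  fix z assume "z \<in> U"
  then show "(\<Sum>b\<in>Basis. (X z \<bullet> b) * frechet_derivative f (at z) b) = field_deriv X f z"
    using field_deriv_expand[OF smooth_on_differentiable[OF assms(3)]] by simp
qed

text \<open>Apply the mean value theorem in the direction \<open>u\<close> to the increment of \<open>f\<close> in the direction \<open>v\<close>,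
  and then once more in the direction \<open>v\<close>. The left-hand side is symmetric in \<open>u\<close> and \<open>v\<close>, which is
  what makes the mixed second derivatives agree.\<close>

lemma second_difference_mean_value:
  fixes f :: "'e::real_normed_vector \<Rightarrow> real"
  assumes "t > 0"
    and sq: "\<And>s r. 0 \<le> s \<Longrightarrow> s \<le> t \<Longrightarrow> 0 \<le> r \<Longrightarrow> r \<le> t \<Longrightarrow> z + s *\<^sub>R u + r *\<^sub>R v \<in> U"
    and f: "\<And>x. x \<in> U \<Longrightarrow> (f has_derivative f' x) (at x)"
    and f'': "\<And>x. x \<in> U \<Longrightarrow> ((\<lambda>x. f' x u) has_derivative f'' x) (at x)"
  shows "\<exists>s r. 0 < s \<and> s < t \<and> 0 < r \<and> r < t \<and>
    f (z + t *\<^sub>R u + t *\<^sub>R v) - f (z + t *\<^sub>R u) - f (z + t *\<^sub>R v) + f z =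
    t * t * f'' (z + s *\<^sub>R u + r *\<^sub>R v) v"
proof -
  define g where "g s = f (z + s *\<^sub>R u + t *\<^sub>R v) - f (z + s *\<^sub>R u + 0 *\<^sub>R v)" for s
  have g: "(g has_derivative (\<lambda>d. d * (f' (z + s *\<^sub>R u + t *\<^sub>R v) u - f' (z + s *\<^sub>R u + 0 *\<^sub>R v) u))) (at s)"
    if "0 \<le> s" "s \<le> t" for s
  proof -
    have "((\<lambda>s. f (z + s *\<^sub>R u + r *\<^sub>R v)) has_derivative (\<lambda>d. f' (z + s *\<^sub>R u + r *\<^sub>R v) (d *\<^sub>R u))) (at s)"
      if r: "0 \<le> r" "r \<le> t" for r
      by (rule has_derivative_compose[OF _ f]) (use sq that \<open>0 \<le> s\<close> \<open>s \<le> t\<close> in \<open>auto intro!: derivative_eq_intros\<close>)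
    moreover have "f' x (d *\<^sub>R u) = d * f' x u" if "x \<in> U" for x d
      using linear_scale[OF has_derivative_linear[OF f[OF that]]] by simp
    ultimately have "((\<lambda>s. f (z + s *\<^sub>R u + r *\<^sub>R v)) has_derivative (\<lambda>d. d * f' (z + s *\<^sub>R u + r *\<^sub>R v) u)) (at s)"
      if r: "0 \<le> r" "r \<le> t" for r
      using sq r \<open>0 \<le> s\<close> \<open>s \<le> t\<close> by simp
    from has_derivative_diff[OF this[of t] this[of 0]] \<open>t > 0\<close>
    show ?thesis unfolding g_def by (simp add: right_diff_distrib)
  qed
  have "\<exists>s. s \<in> {0<..<t} \<and> g t - g 0 = (t - 0) * (f' (z + s *\<^sub>R u + t *\<^sub>R v) u - f' (z + s *\<^sub>R u + 0 *\<^sub>R v) u)"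
    using mvt_simple[OF \<open>t > 0\<close>, of g "\<lambda>s d. d * (f' (z + s *\<^sub>R u + t *\<^sub>R v) u - f' (z + s *\<^sub>R u + 0 *\<^sub>R v) u)"] g
    by (metis (no_types, lifting) atLeastAtMost_iff has_derivative_at_withinI)
  then obtain s where s: "0 < s" "s < t"
    and gs: "g t - g 0 = t * (f' (z + s *\<^sub>R u + t *\<^sub>R v) u - f' (z + s *\<^sub>R u + 0 *\<^sub>R v) u)" by auto
  define k where "k r = f' (z + s *\<^sub>R u + r *\<^sub>R v) u" for r
  have k: "(k has_derivative (\<lambda>d. d * f'' (z + s *\<^sub>R u + r *\<^sub>R v) v)) (at r)" if "0 \<le> r" "r \<le> t" for r
  proof -
    have U: "z + s *\<^sub>R u + r *\<^sub>R v \<in> U" using sq s that by simp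
    have "((\<lambda>r. f' (z + s *\<^sub>R u + r *\<^sub>R v) u) has_derivative (\<lambda>d. f'' (z + s *\<^sub>R u + r *\<^sub>R v) (d *\<^sub>R v))) (at r)"
      by (rule has_derivative_compose[where g = "\<lambda>x. f' x u" and f = "\<lambda>r. z + s *\<^sub>R u + r *\<^sub>R v"])
        (use f''[OF U] in \<open>auto intro!: derivative_eq_intros\<close>)
    then show ?thesis
      unfolding k_def using linear_scale[OF has_derivative_linear[OF f''[OF U]]] by simp
  qed
  have "\<exists>r. r \<in> {0<..<t} \<and> k t - k 0 = (t - 0) * f'' (z + s *\<^sub>R u + r *\<^sub>R v) v"
    using mvt_simple[OF \<open>t > 0\<close>, of k "\<lambda>r d. d * f'' (z + s *\<^sub>R u + r *\<^sub>R v) v"] k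
    by (metis (no_types, lifting) atLeastAtMost_iff has_derivative_at_withinI)
  then obtain r where r: "0 < r" "r < t" "k t - k 0 = t * f'' (z + s *\<^sub>R u + r *\<^sub>R v) v" by auto
  have "g t - g 0 = t * t * f'' (z + s *\<^sub>R u + r *\<^sub>R v) v"
    using gs r(3) unfolding k_def by simp
  then show ?thesis
    using s r by (intro exI[of _ s] exI[of _ r]) (simp add: g_def)
qed

text \<open>If the two mixed derivatives differed at \<open>z\<close>, then by continuity they would stay apart on a
  small ball, whereas the symmetric second difference is a value of either one inside any small
  parallelogram at \<open>z\<close>.\<close>

lemma second_derivative_commute:
  fixes f :: "'e::real_normed_vector \<Rightarrow> real"
  assumes U: "open U" "z \<in> U" and f: "smooth_on U f"
  shows "frechet_derivative (\<lambda>x. frechet_derivative f (at x) u) (at z) v =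
         frechet_derivative (\<lambda>x. frechet_derivative f (at x) v) (at z) u"
proof (rule ccontr)
  define D where "D u v x = frechet_derivative (\<lambda>x. frechet_derivative f (at x) u) (at x) v" for u v x
  assume "\<not> ?thesis"
  then have ne: "D u v z \<noteq> D v u z" by (simp add: D_def)
  define e where "e = \<bar>D u v z - D v u z\<bar> / 2"
  have e: "e > 0" using ne by (simp add: e_def)
  have "continuous_on U (D u v)" for u v
    using f unfolding smooth_on_def D_def by (metis Ck_on.simps)
  then have cont: "isCont (D u v) z" for u v
    using U continuous_on_eq_continuous_at by blast
  have "\<forall>\<^sub>F x in nhds z. dist (D a b x) (D a b z) < e" for a b
    using cont[of a b] e unfolding isCont_def
    by (metis cont isCont_def tendstoD tendsto_at_iff_tendsto_nhds)
  then have "\<forall>\<^sub>F x in nhds z. x \<in> U \<and> dist (D u v x) (D u v z) < e \<and> dist (D v u x) (D v u z) < e"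
    using U eventually_nhds_in_open by (intro eventually_conj) auto
  then obtain d where d: "d > 0" and
    near: "\<And>x. dist x z < d \<Longrightarrow> x \<in> U \<and> dist (D u v x) (D u v z) < e \<and> dist (D v u x) (D v u z) < e"
    by (auto simp: eventually_nhds_metric)
  \<comment> \<open>A side length for which the parallelogram spanned by \<open>t u\<close> and \<open>t v\<close> stays in the ball of radius \<open>d\<close>.\<close>
  define t where "t = d / (2 * (norm u + norm v + 1))"
  have N: "norm u + norm v + 1 > 0" by (simp add: add_nonneg_pos)
  have t: "t > 0" using d N by (simp add: t_def)
  have close: "dist (z + s *\<^sub>R u + r *\<^sub>R v) z < d" "dist (z + s *\<^sub>R v + r *\<^sub>R u) z < d"
    if "0 \<le> s" "s \<le> t" "0 \<le> r" "r \<le> t" for s r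
  proof -
    have *: "norm (s *\<^sub>R a + r *\<^sub>R b) \<le> t * norm a + t * norm b" for a b :: 'e
      using that by (intro order_trans[OF norm_triangle_ineq] add_mono) (auto intro: mult_right_mono)
    have "t * (norm u + norm v) \<le> t * (norm u + norm v + 1)" using t by simp
    also have "\<dots> = d / 2" using N by (simp add: t_def field_simps)
    also have "\<dots> < d" using d by simp
    finally have "t * norm u + t * norm v < d" by (simp add: distrib_left)
    then show "dist (z + s *\<^sub>R u + r *\<^sub>R v) z < d" "dist (z + s *\<^sub>R v + r *\<^sub>R u) z < d"
      using *[of u v] *[of v u] by (auto simp: dist_norm)
  qed
  have d1: "(f has_derivative frechet_derivative f (at x)) (at x)" if "x \<in> U" for x
    using smooth_on_has_derivative[OF f that] .
  have d2: "((\<lambda>x. frechet_derivative f (at x) a) has_derivative (\<lambda>b. D a b x)) (at x)" if "x \<in> U" for x a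
    unfolding D_def using smooth_on_has_derivative[OF smooth_on_frechet_derivative[OF f] that] .
  obtain s r where sr: "0 < s" "s < t" "0 < r" "r < t" and
    e1: "f (z + t *\<^sub>R u + t *\<^sub>R v) - f (z + t *\<^sub>R u) - f (z + t *\<^sub>R v) + f z =
      t * t * D u v (z + s *\<^sub>R u + r *\<^sub>R v)"
    using second_difference_mean_value[OF t, of z u v U f, OF _ d1 d2] close near by blast
  obtain s' r' where sr': "0 < s'" "s' < t" "0 < r'" "r' < t" and
    e2: "f (z + t *\<^sub>R v + t *\<^sub>R u) - f (z + t *\<^sub>R v) - f (z + t *\<^sub>R u) + f z =
      t * t * D v u (z + s' *\<^sub>R v + r' *\<^sub>R u)"
    using second_difference_mean_value[OF t, of z v u U f, OF _ d1 d2] close near by blast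
  have comm: "z + t *\<^sub>R v + t *\<^sub>R u = z + t *\<^sub>R u + t *\<^sub>R v" by simp
  have "t * t * D u v (z + s *\<^sub>R u + r *\<^sub>R v) = t * t * D v u (z + s' *\<^sub>R v + r' *\<^sub>R u)"
    using e1 e2[unfolded comm] by linarith
  then have "D u v (z + s *\<^sub>R u + r *\<^sub>R v) = D v u (z + s' *\<^sub>R v + r' *\<^sub>R u)" using t by simp
  moreover have "dist (D u v (z + s *\<^sub>R u + r *\<^sub>R v)) (D u v z) < e"
    "dist (D v u (z + s' *\<^sub>R v + r' *\<^sub>R u)) (D v u z) < e"
    using near close sr sr' by (meson less_imp_le)+
  ultimately show False
    unfolding e_def dist_real_def by argo
qed

text \<open>In \<open>X(Y(f)) - Y(X(f))\<close> the terms with second derivatives of \<open>f\<close> cancel by symmetry. The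
  fields are differentiable at one point only, because the identity is meant for the geodesic spray,
  whose coefficients are quotients.\<close>

lemma field_deriv_bracket:
  fixes f :: "'e::euclidean_space \<Rightarrow> real"
  assumes U: "open U" "z \<in> U" and f: "smooth_on U f"
    and X: "X differentiable (at z)" and Y: "Y differentiable (at z)"
  shows "field_deriv (field_bracket X Y) f z =
    field_deriv X (field_deriv Y f) z - field_deriv Y (field_deriv X f) z"
proof -
  define D where "D u v = frechet_derivative (\<lambda>x. frechet_derivative f (at x) u) (at z) v" for u v
  have lin: "linear (frechet_derivative f (at z))" "linear (D u)" for u
    unfolding D_def using U f smooth_on_differentiable smooth_on_frechet_derivative linear_frechet_derivative by blast+
  have *: "field_deriv X (field_deriv Y f) z = frechet_derivative f (at z) (frechet_derivative Y (at z) (X z)) +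
      (\<Sum>b\<in>Basis. \<Sum>b'\<in>Basis. (Y z \<bullet> b) * (X z \<bullet> b') * D b b')"
    if Y: "Y differentiable (at z)" for X Y :: "'e \<Rightarrow> 'e"
  proof -
    have "((\<lambda>z. \<Sum>b\<in>Basis. (Y z \<bullet> b) * frechet_derivative f (at z) b) has_derivative
       (\<lambda>w. \<Sum>b\<in>Basis. (Y z \<bullet> b) * D b w + (frechet_derivative Y (at z) w \<bullet> b) * frechet_derivative f (at z) b)) (at z)"
      unfolding D_def
      by (intro has_derivative_sum has_derivative_mult has_derivative_inner_left
          smooth_on_has_derivative[OF smooth_on_frechet_derivative[OF f] U(2)])
        (use Y frechet_derivative_works in blast)
    then have "((field_deriv Y f) has_derivative
       (\<lambda>w. \<Sum>b\<in>Basis. (Y z \<bullet> b) * D b w + (frechet_derivative Y (at z) w \<bullet> b) * frechet_derivative f (at z) b)) (at z)"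
      by (rule has_derivative_transform_within_open[OF _ U])
        (simp add: field_deriv_expand[OF smooth_on_differentiable[OF f]])
    from fun_cong[OF frechet_derivative_at[OF this], of "X z"]
    have "field_deriv X (field_deriv Y f) z =
      (\<Sum>b\<in>Basis. (Y z \<bullet> b) * D b (X z) + (frechet_derivative Y (at z) (X z) \<bullet> b) * frechet_derivative f (at z) b)"
      by (simp only: field_deriv_def[of X])
    also have "\<dots> = (\<Sum>b\<in>Basis. (Y z \<bullet> b) * D b (X z)) + frechet_derivative f (at z) (frechet_derivative Y (at z) (X z))"
      by (subst (2) linear_expand_Basis[OF lin(1)]) (simp add: sum.distrib)
    also have "(\<Sum>b\<in>Basis. (Y z \<bullet> b) * D b (X z)) = (\<Sum>b\<in>Basis. \<Sum>b'\<in>Basis. (Y z \<bullet> b) * (X z \<bullet> b') * D b b')"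
      by (subst linear_expand_Basis[OF lin(2)]) (simp add: sum_distrib_left mult.assoc)
    finally show ?thesis by simp
  qed
  have "(\<Sum>b\<in>Basis. \<Sum>b'\<in>Basis. (Y z \<bullet> b) * (X z \<bullet> b') * D b b') =
        (\<Sum>b\<in>Basis. \<Sum>b'\<in>Basis. (X z \<bullet> b) * (Y z \<bullet> b') * D b b')"
    by (subst sum.swap) (simp add: D_def second_derivative_commute[OF U f] mult.commute)
  then show ?thesis
    unfolding *[OF X] *[OF Y] by (simp add: field_deriv_def field_bracket_def linear_diff[OF lin(1)])
qed

section \<open>Charts and the slit tangent bundle\<close>

lemma chart_cinv:
  assumes "z \<in> cimage c"
  shows "cinv c z \<in> fst c" "snd c (cinv c z) = z"
  using assms by (auto simp: cimage_def cinv_def inv_into_into f_inv_into_f)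

lemma in_cimage: "u \<in> fst c \<Longrightarrow> snd c u \<in> cimage c"
  by (simp add: cimage_def)

text \<open>The part of a manifold structure on which chart-independence of tangent vectors and of
  directional derivatives rests. It holds both for the surface and for its slit tangent bundle.\<close>

locale differentiable_atlas =
  fixes B :: "('q, 'e::euclidean_space) chart set"
  assumes inj: "c \<in> B \<Longrightarrow> inj_on (snd c) (fst c)"
    and open_overlap: "c \<in> B \<Longrightarrow> d \<in> B \<Longrightarrow> open (snd c ` (fst c \<inter> fst d))"
    and transition: "c \<in> B \<Longrightarrow> d \<in> B \<Longrightarrow> u \<in> fst c \<Longrightarrow> u \<in> fst d \<Longrightarrow>
      (snd d \<circ> cinv c) differentiable (at (snd c u))"
begin

lemma cinv_chart: "c \<in> B \<Longrightarrow> u \<in> fst c \<Longrightarrow> cinv c (snd c u) = u"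
  by (simp add: cinv_def inv_into_f_f inj)

lemma open_cimage: "c \<in> B \<Longrightarrow> open (cimage c)"
  using open_overlap[of c c] by (simp add: cimage_def)

lemma frechet_derivative_change_chart:
  assumes "c \<in> B" "d \<in> B" "u \<in> fst c" "u \<in> fst d" and g: "(g \<circ> cinv d) differentiable (at (snd d u))"
  shows "frechet_derivative (g \<circ> cinv c) (at (snd c u)) =
    frechet_derivative (g \<circ> cinv d) (at (snd d u)) \<circ> frechet_derivative (snd d \<circ> cinv c) (at (snd c u))"
proof -
  have t: "(snd d \<circ> cinv c) (snd c u) = snd d u" using assms by (simp add: cinv_chart)
  have "((g \<circ> cinv d) \<circ> (snd d \<circ> cinv c) has_derivative
      frechet_derivative (g \<circ> cinv d) (at (snd d u)) \<circ> frechet_derivative (snd d \<circ> cinv c) (at (snd c u)))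
      (at (snd c u))"
    by (rule diff_chain_at) (use g transition[OF assms(1-4)] t frechet_derivative_works in auto)
  then have "(g \<circ> cinv c has_derivative
      frechet_derivative (g \<circ> cinv d) (at (snd d u)) \<circ> frechet_derivative (snd d \<circ> cinv c) (at (snd c u)))
      (at (snd c u))"
    by (rule has_derivative_transform_within_open[OF _ open_overlap[OF assms(1,2)]])
      (use assms in \<open>auto simp: cinv_chart\<close>)
  then show ?thesis by (rule frechet_derivative_at[symmetric])
qed

lemma transition_self:
  assumes "c \<in> B" "u \<in> fst c"
  shows "frechet_derivative (snd c \<circ> cinv c) (at (snd c u)) y = y"
proof -
  have "((\<lambda>x. x) has_derivative (\<lambda>x. x)) (at (snd c u))" by simp
  then have "(snd c \<circ> cinv c has_derivative (\<lambda>x. x)) (at (snd c u))"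
    by (rule has_derivative_transform_within_open[OF _ open_cimage[OF assms(1)] in_cimage[OF assms(2)]])
      (simp add: chart_cinv)
  from frechet_derivative_at[OF this] show ?thesis by metis
qed

lemma tangent_vector_change_chart:
  assumes "w \<in> tangent_space B u" "c \<in> B" "d \<in> B" "u \<in> fst c" "u \<in> fst d"
  shows "w d = frechet_derivative (snd d \<circ> cinv c) (at (snd c u)) (w c)"
  using assms unfolding tangent_space_def by blast

lemma tangent_vector_eqI:
  assumes "w \<in> tangent_space B u" "w' \<in> tangent_space B u" "c \<in> B" "u \<in> fst c" "w c = w' c"
  shows "w = w'"
proof
  fix d
  show "w d = w' d"
  proof (cases "d \<in> B \<and> u \<in> fst d")
    case True
    then show ?thesis
      using assms tangent_vector_change_chart by metis
  next
    case False
    then have "w d = 0" "w' d = 0" using assms(1,2) unfolding tangent_space_def by blast+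
    then show ?thesis by simp
  qed
qed

lemma zero_in_tangent_space: "(\<lambda>_. 0) \<in> tangent_space B u"
proof -
  have "frechet_derivative (snd d \<circ> cinv c) (at (snd c u)) 0 = 0"
    if "c \<in> B" "d \<in> B" "u \<in> fst c \<inter> fst d" for c d
    using transition[of c d u] that by (simp add: linear_0 linear_frechet_derivative)
  then show ?thesis by (simp add: tangent_space_def)
qed

text \<open>Push the prescribed components forward by the coordinate changes; the chain rule is exactly
  the compatibility condition between two further charts.\<close>

lemma tangent_vector_exists:
  assumes "c \<in> B" "u \<in> fst c"
  obtains w where "w \<in> tangent_space B u" "w c = y"
proof -
  define w where
    "w d = (if d \<in> B \<and> u \<in> fst d then frechet_derivative (snd d \<circ> cinv c) (at (snd c u)) y else 0)" for d
  have "w e = frechet_derivative (snd e \<circ> cinv d) (at (snd d u)) (w d)"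
    if "d \<in> B" "e \<in> B" "u \<in> fst d" "u \<in> fst e" for d e
    using that assms frechet_derivative_change_chart[of c d u "snd e"]
    by (simp add: w_def transition)
  moreover have "w d = 0" if "\<not> (d \<in> B \<and> u \<in> fst d)" for d
    using that by (auto simp: w_def)
  ultimately have "w \<in> tangent_space B u"
    unfolding tangent_space_def by blast
  moreover have "w c = y" using assms by (simp add: w_def transition_self)
  ultimately show thesis by (rule that)
qed

lemma directional_in_chart:
  assumes f: "\<And>d. d \<in> B \<Longrightarrow> u \<in> fst d \<Longrightarrow> (f \<circ> cinv d) differentiable (at (snd d u))"
    and w: "w \<in> tangent_space B u" and c: "c \<in> B" "u \<in> fst c"
  shows "directional B f u w = frechet_derivative (f \<circ> cinv c) (at (snd c u)) (w c)"
proof -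
  define d where "d = (SOME c. c \<in> B \<and> u \<in> fst c)"
  have d: "d \<in> B" "u \<in> fst d" unfolding d_def using someI[of "\<lambda>c. c \<in> B \<and> u \<in> fst c", OF conjI[OF c]] by simp_all
  have "directional B f u w = frechet_derivative (f \<circ> cinv d) (at (snd d u)) (w d)"
    by (simp add: directional_def d_def Let_def)
  also have "\<dots> = frechet_derivative (f \<circ> cinv c) (at (snd c u)) (w c)"
    using frechet_derivative_change_chart[OF c(1) d(1) c(2) d(2) f[OF d]]
      tangent_vector_change_chart[OF w c(1) d(1) c(2) d(2)] by simp
  finally show ?thesis .
qed

lemma smooth_function_differentiable:
  "smooth_function B f \<Longrightarrow> d \<in> B \<Longrightarrow> u \<in> fst d \<Longrightarrow> (f \<circ> cinv d) differentiable (at (snd d u))"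
  by (rule smooth_on_differentiable[OF _ in_cimage]) (simp_all add: smooth_function_def)

lemma vf_apply_in_chart:
  assumes "smooth_function B f" "vector_field B X" "c \<in> B" "z \<in> cimage c"
  shows "vf_apply B X f (cinv c z) = field_deriv (local_rep X c) (f \<circ> cinv c) z"
proof -
  have "X (cinv c z) \<in> tangent_space B (cinv c z)"
    using assms chart_cinv[OF assms(4)] unfolding vector_field_def points_def by blast
  then show ?thesis
    using directional_in_chart[of "cinv c z" f "X (cinv c z)" c] assms(3) chart_cinv[OF assms(4)]
      smooth_function_differentiable[OF assms(1)]
    by (simp add: vf_apply_def field_deriv_def local_rep_def)
qed

lemma smooth_function_vf_apply:
  assumes "smooth_function B f" "vector_field B X"
  shows "smooth_function B (vf_apply B X f)"
  unfolding smooth_function_def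
proof
  fix c assume c: "c \<in> B"
  have "smooth_on (cimage c) (field_deriv (local_rep X c) (f \<circ> cinv c))"
    using assms c by (intro smooth_on_field_deriv open_cimage) (auto simp: smooth_function_def vector_field_def)
  then show "smooth_on (cimage c) (vf_apply B X f \<circ> cinv c)"
    by (rule smooth_on_cong[OF open_cimage[OF c], rotated])
      (simp add: vf_apply_in_chart[OF assms c])
qed

lemma lie_bracket_in_chart:
  assumes "c \<in> B" "z \<in> cimage c"
  shows "lie_bracket B X Y (cinv c z) c = field_bracket (local_rep X c) (local_rep Y c) z"
  using assms chart_cinv[OF assms(2)] by (simp add: lie_bracket_def field_of_comps_def field_bracket_def)

text \<open>A field \<open>Z\<close> that is given through \<open>[X,Y] = Z + a X + b Y\<close> differentiates functions
  independently of the chart: in any chart \<open>Z(f) = X(Y(f)) - Y(X(f)) - a X(f) - b Y(f)\<close>, and the right-hand side only contains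
  the vector fields \<open>X\<close> and \<open>Y\<close>. Applied to \<open>[H,V] = S + I H + S(I) V\<close>, this replaces the computation
  of the transformation law of the spray coefficients.\<close>

lemma bracket_combination_in_chart:
  assumes X: "vector_field B X" and Y: "vector_field B Y" and f: "smooth_function B f"
    and br: "\<And>u c. c \<in> B \<Longrightarrow> u \<in> fst c \<Longrightarrow> lie_bracket B X Y u c = Z u c + a u *\<^sub>R X u c + b u *\<^sub>R Y u c"
    and c: "c \<in> B" "z \<in> cimage c"
  shows "vf_apply B Z f (cinv c z) = field_deriv (local_rep Z c) (f \<circ> cinv c) z"
proof -
  define E where "E u = vf_apply B X (vf_apply B Y f) u - vf_apply B Y (vf_apply B X f) u
    - a u * vf_apply B X f u - b u * vf_apply B Y f u" for u
  have E: "field_deriv (local_rep Z c) (f \<circ> cinv c) z = E (cinv c z)" if c: "c \<in> B" "z \<in> cimage c" for c z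
  proof -
    let ?U = "cimage c" and ?u = "cinv c z" and ?f = "f \<circ> cinv c"
    let ?X = "local_rep X c" and ?Y = "local_rep Y c" and ?Z = "local_rep Z c"
    have sX: "smooth_on ?U ?X" and sY: "smooth_on ?U ?Y" and sf: "smooth_on ?U ?f"
      using X Y f c(1) by (auto simp: vector_field_def smooth_function_def)
    have lin: "linear (frechet_derivative ?f (at z))"
      using smooth_on_differentiable[OF sf c(2)] by (rule linear_frechet_derivative)
    have iter: "vf_apply B W (vf_apply B W' f) ?u = field_deriv (local_rep W c) (field_deriv (local_rep W' c) ?f) z"
      if "vector_field B W" "vector_field B W'" for W W'
    proof -
      have "vf_apply B W (vf_apply B W' f) ?u = field_deriv (local_rep W c) (vf_apply B W' f \<circ> cinv c) z"
        using smooth_function_vf_apply that f c by (intro vf_apply_in_chart) auto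
      also have "\<dots> = field_deriv (local_rep W c) (field_deriv (local_rep W' c) ?f) z"
      proof (rule field_deriv_cong[OF open_cimage[OF c(1)] c(2)])
        show "(vf_apply B W' f \<circ> cinv c) differentiable at z"
          using smooth_function_vf_apply[OF f that(2)] c
          by (intro smooth_on_differentiable[of "cimage c"]) (simp_all add: smooth_function_def)
      qed (simp add: vf_apply_in_chart[OF f that(2) c(1)])
      finally show ?thesis .
    qed
    have "?Z z = field_bracket ?X ?Y z - a ?u *\<^sub>R ?X z - b ?u *\<^sub>R ?Y z"
      using br[OF c(1) chart_cinv(1)[OF c(2)]] lie_bracket_in_chart[OF c, of X Y]
      by (simp add: local_rep_def)
    then have "field_deriv ?Z ?f z = field_deriv (field_bracket ?X ?Y) ?f z
        - a ?u * field_deriv ?X ?f z - b ?u * field_deriv ?Y ?f z"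
      by (simp add: field_deriv_def linear_diff[OF lin] linear_scale[OF lin])
    also have "\<dots> = E ?u"
      using field_deriv_bracket[OF open_cimage[OF c(1)] c(2) sf smooth_on_differentiable[OF sX c(2)]
          smooth_on_differentiable[OF sY c(2)]]
      by (simp add: E_def iter X Y vf_apply_in_chart[OF f _ c])
    finally show ?thesis .
  qed
  \<comment> \<open>The chart in which \<^const>\<open>vf_apply\<close> happens to be evaluated.\<close>
  define d where "d = (SOME d. d \<in> B \<and> cinv c z \<in> fst d)"
  have d: "d \<in> B" "cinv c z \<in> fst d"
    unfolding d_def using someI[of "\<lambda>d. d \<in> B \<and> cinv c z \<in> fst d", OF conjI[OF c(1) chart_cinv(1)[OF c(2)]]]
    by simp_all
  have "vf_apply B Z f (cinv c z) = field_deriv (local_rep Z d) (f \<circ> cinv d) (snd d (cinv c z))"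
    using d by (simp add: vf_apply_def directional_def Let_def field_deriv_def local_rep_def cinv_chart flip: d_def)
  also have "\<dots> = E (cinv c z)"
    using E[OF d(1) in_cimage[OF d(2)]] d by (simp add: cinv_chart)
  finally show ?thesis using E[OF c] by simp
qed

end

lemma smooth_manifold_differentiable_atlas:
  assumes "smooth_manifold M A"
  shows "differentiable_atlas A"
proof
  fix c assume c: "c \<in> A"
  have hom: "homeomorphic_map (subtopology M (fst c)) (top_of_set (cimage c)) (snd c)"
    and op: "openin M (fst c)" "open (cimage c)"
    using assms c unfolding smooth_manifold_def by blast+
  have top: "topspace (subtopology M (fst c)) = fst c"
    using openin_subset[OF op(1)] by auto
  show "inj_on (snd c) (fst c)"
    using homeomorphic_imp_injective_map[OF hom] top by simp
  fix d assume d: "d \<in> A"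
  have "openin M (fst d)" using assms d unfolding smooth_manifold_def by blast
  then have "openin (subtopology M (fst c)) (fst c \<inter> fst d)"
    by (rule openin_subtopology_Int2)
  then have "openin (top_of_set (cimage c)) (snd c ` (fst c \<inter> fst d))"
    using homeomorphic_imp_open_map[OF hom] by (simp add: open_map_def)
  then show o: "open (snd c ` (fst c \<inter> fst d))"
    using op(2) openin_open_trans by blast
  fix u assume "u \<in> fst c" "u \<in> fst d"
  then show "(snd d \<circ> cinv c) differentiable (at (snd c u))"
    using assms c d unfolding smooth_manifold_def
    by (intro smooth_on_differentiable[of "snd c ` (fst c \<inter> fst d)"]) auto
qed

definition slit_chart :: "('p, 'e::euclidean_space) chart set \<Rightarrow> ('p, 'e) chart \<Rightarrow> (('p, 'e) tvec, 'e \<times> 'e) chart" where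
  "slit_chart A c = ({u \<in> slit A. fst u \<in> fst c}, \<lambda>u. (snd c (fst u), snd u c))"

lemma slit_atlas_eq: "slit_atlas A = slit_chart A ` A"
  by (simp add: slit_atlas_def slit_chart_def)

context differentiable_atlas
begin

lemma slit_chart_inj:
  assumes "c \<in> B"
  shows "inj_on (snd (slit_chart B c)) (fst (slit_chart B c))"
proof (rule inj_onI)
  fix u u' assume u: "u \<in> fst (slit_chart B c)" "u' \<in> fst (slit_chart B c)"
    and eq: "snd (slit_chart B c) u = snd (slit_chart B c) u'"
  have "fst u = fst u'"
    using u eq inj_onD[OF inj[OF assms]] by (auto simp: slit_chart_def)
  moreover have "snd u = snd u'"
    using u eq assms calculation
    by (intro tangent_vector_eqI[of _ "fst u" _ c]) (auto simp: slit_chart_def slit_def tangent_bundle_def)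
  ultimately show "u = u'" by (simp add: prod_eq_iff)
qed

text \<open>Every nonzero vector occurs because tangent vectors with prescribed components in one chart
  exist; zero does not, because the components in one chart determine the vector.\<close>

lemma cimage_slit_chart:
  assumes c: "c \<in> B"
  shows "cimage (slit_chart B c) = cimage c \<times> (- {0 :: 'e})"
proof (intro equalityI subsetI)
  fix z assume "z \<in> cimage (slit_chart B c)"
  then obtain u where u: "u \<in> slit B" "fst u \<in> fst c" "z = (snd c (fst u), snd u c)"
    by (auto simp: cimage_def slit_chart_def)
  have "snd u c \<noteq> 0"
    using u tangent_vector_eqI[of "snd u" "fst u" "\<lambda>_. 0" c] c zero_in_tangent_space
    by (auto simp: slit_def tangent_bundle_def)
  then show "z \<in> cimage c \<times> (- {0 :: 'e})" using u by (auto simp: cimage_def)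
next
  fix z assume "z \<in> cimage c \<times> (- {0 :: 'e})"
  then obtain p y where z: "z = (snd c p, y)" "p \<in> fst c" "y \<noteq> 0" by (auto simp: cimage_def)
  obtain w where w: "w \<in> tangent_space B p" "w c = y"
    using tangent_vector_exists[OF c z(2)] .
  have "w \<noteq> (\<lambda>_. 0)" using w z by auto
  then have "(p, w) \<in> fst (slit_chart B c)"
    using w z c by (auto simp: slit_chart_def slit_def tangent_bundle_def points_def)
  moreover have "z = snd (slit_chart B c) (p, w)" using z w by (simp add: slit_chart_def)
  ultimately show "z \<in> cimage (slit_chart B c)" unfolding cimage_def by blast
qed

lemma slit_chart_overlap:
  assumes "c \<in> B" "d \<in> B"
  shows "snd (slit_chart B c) ` (fst (slit_chart B c) \<inter> fst (slit_chart B d)) =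
    (snd c ` (fst c \<inter> fst d)) \<times> (- {0 :: 'e})"
proof (intro equalityI subsetI)
  fix z assume z: "z \<in> snd (slit_chart B c) ` (fst (slit_chart B c) \<inter> fst (slit_chart B d))"
  then have "z \<in> cimage (slit_chart B c)" by (auto simp: cimage_def)
  then show "z \<in> (snd c ` (fst c \<inter> fst d)) \<times> (- {0 :: 'e})"
    using z unfolding cimage_slit_chart[OF assms(1)] by (auto simp: slit_chart_def)
next
  fix z assume z: "z \<in> (snd c ` (fst c \<inter> fst d)) \<times> (- {0 :: 'e})"
  then have "z \<in> cimage (slit_chart B c)"
    unfolding cimage_slit_chart[OF assms(1)] by (auto simp: cimage_def)
  then obtain u where u: "u \<in> slit B" "fst u \<in> fst c" "z = (snd c (fst u), snd u c)"
    by (auto simp: cimage_def slit_chart_def)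
  then have "fst u \<in> fst d" using z inj_onD[OF inj[OF assms(1)]] by auto
  then show "z \<in> snd (slit_chart B c) ` (fst (slit_chart B c) \<inter> fst (slit_chart B d))"
    using u by (auto simp: slit_chart_def intro!: image_eqI[of _ _ u])
qed

lemma slit_transition:
  assumes c: "c \<in> B" and d: "d \<in> B" and z: "z \<in> (snd c ` (fst c \<inter> fst d)) \<times> (- {0 :: 'e})"
  shows "(snd (slit_chart B d) \<circ> cinv (slit_chart B c)) z =
    ((snd d \<circ> cinv c) (fst z), frechet_derivative (snd d \<circ> cinv c) (at (fst z)) (snd z))"
proof -
  obtain u where u: "u \<in> fst (slit_chart B c)" "u \<in> fst (slit_chart B d)" "z = snd (slit_chart B c) u"
    using z unfolding slit_chart_overlap[OF c d, symmetric] by blast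
  have "cinv (slit_chart B c) z = u"
    using u slit_chart_inj[OF c] by (simp add: cinv_def inv_into_f_f)
  moreover have "snd u \<in> tangent_space B (fst u)" "fst u \<in> fst c" "fst u \<in> fst d"
    using u by (auto simp: slit_chart_def slit_def tangent_bundle_def)
  ultimately show ?thesis
    using u(3) c d tangent_vector_change_chart[of "snd u" "fst u" c d]
    by (simp add: slit_chart_def cinv_chart)
qed

end

text \<open>The transition map is \<open>(x, y) \<mapsto> (\<phi>(x), D\<phi>(x) y)\<close>. It is linear in \<open>y\<close>, so its derivative has
  the block form \<open>(\<xi>, \<eta>) \<mapsto> (D\<phi> \<xi>, D\<^sup>2\<phi>(y, \<xi>) + D\<phi> \<eta>)\<close> with the same diagonal blocks, and
  this makes the almost-tangent structure independent of the chart.\<close>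

lemma slit_transition_has_derivative:
  assumes A: "differentiable_atlas A" and c: "c \<in> A" and d: "d \<in> A"
    and sm: "smooth_on (snd c ` (fst c \<inter> fst d)) (snd d \<circ> cinv c)"
    and z: "z \<in> (snd c ` (fst c \<inter> fst d)) \<times> (- {0})"
  shows "\<exists>L. (snd (slit_chart A d) \<circ> cinv (slit_chart A c) has_derivative L) (at z) \<and>
    (\<forall>\<xi> \<eta>. L (0, \<xi>) = (0, fst (L (\<xi>, \<eta>))))"
proof -
  interpret differentiable_atlas A by fact
  define W where "W = snd c ` (fst c \<inter> fst d)"
  define \<phi> where "\<phi> = snd d \<circ> cinv c"
  define D where "D b x = frechet_derivative \<phi> (at x) b" for b x
  have W: "open W" "fst z \<in> W" "snd z \<noteq> 0"
    using open_overlap[OF c d] z by (auto simp: W_def)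
  have sm\<phi>: "smooth_on W \<phi>" using sm by (simp add: W_def \<phi>_def)
  have lin: "linear (frechet_derivative \<phi> (at x))" if "x \<in> W" for x
    using smooth_on_differentiable[OF sm\<phi> that] by (rule linear_frechet_derivative)
  define P where "P w = (\<Sum>b\<in>Basis. (snd z \<bullet> b) *\<^sub>R frechet_derivative (D b) (at (fst z)) (fst w) +
      (snd w \<bullet> b) *\<^sub>R D b (fst z))" for w :: "'b \<times> 'b"
  have D1: "((\<lambda>w. \<phi> (fst w)) has_derivative (\<lambda>w. frechet_derivative \<phi> (at (fst z)) (fst w))) (at z)"
    using smooth_on_has_derivative[OF sm\<phi> W(2)]
    by (intro has_derivative_compose[where g = \<phi> and f = fst]) (auto intro!: derivative_eq_intros)
  have Db: "((\<lambda>w. D b (fst w)) has_derivative (\<lambda>w. frechet_derivative (D b) (at (fst z)) (fst w))) (at z)" for b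
    using smooth_on_has_derivative[OF smooth_on_frechet_derivative[OF sm\<phi>] W(2)]
    by (intro has_derivative_compose[where g = "D b" and f = fst])
      (auto intro!: derivative_eq_intros simp: D_def[abs_def])
  have "((\<lambda>w. \<Sum>b\<in>Basis. (snd w \<bullet> b) *\<^sub>R D b (fst w)) has_derivative P) (at z)"
    unfolding P_def by (auto intro!: derivative_eq_intros Db)
  from has_derivative_Pair[OF D1 this]
  have "((\<lambda>w. (\<phi> (fst w), \<Sum>b\<in>Basis. (snd w \<bullet> b) *\<^sub>R D b (fst w))) has_derivative
      (\<lambda>w. (frechet_derivative \<phi> (at (fst z)) (fst w), P w))) (at z)" .
  then have der: "(snd (slit_chart A d) \<circ> cinv (slit_chart A c) has_derivative
      (\<lambda>w. (frechet_derivative \<phi> (at (fst z)) (fst w), P w))) (at z)"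
  proof (rule has_derivative_transform_within_open)
    show "open (W \<times> (- {0} :: 'b set))" using W by (intro open_Times) auto
    show "z \<in> W \<times> - {0}" using W by (auto simp: mem_Times_iff)
    show "(\<phi> (fst w), \<Sum>b\<in>Basis. (snd w \<bullet> b) *\<^sub>R D b (fst w)) =
      (snd (slit_chart A d) \<circ> cinv (slit_chart A c)) w" if "w \<in> W \<times> - {0}" for w
      using slit_transition[OF c d, of w] linear_expand_Basis[OF lin, of "fst w" "snd w"] that
      by (auto simp: W_def \<phi>_def D_def)
  qed
  have "frechet_derivative \<phi> (at (fst z)) 0 = 0" using linear_0[OF lin[OF W(2)]] .
  moreover have "frechet_derivative (D b) (at (fst z)) 0 = 0" for b
    using smooth_on_differentiable[OF smooth_on_frechet_derivative[OF sm\<phi>] W(2), THEN linear_frechet_derivative]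
    by (simp add: D_def[abs_def] linear_0)
  moreover have "P (0, \<xi>) = frechet_derivative \<phi> (at (fst z)) \<xi>" for \<xi>
    using linear_expand_Basis[OF lin[OF W(2)], of \<xi>] calculation(2) by (simp add: P_def D_def)
  ultimately show ?thesis using der by (intro exI conjI) auto
qed

lemma slit_atlas_transition:
  assumes M: "smooth_manifold M A" and c: "c \<in> slit_atlas A" and d: "d \<in> slit_atlas A"
    and u: "u \<in> fst c" "u \<in> fst d"
  shows "(snd d \<circ> cinv c) differentiable (at (snd c u))"
    and "frechet_derivative (snd d \<circ> cinv c) (at (snd c u)) (0, \<xi>) =
      (0, fst (frechet_derivative (snd d \<circ> cinv c) (at (snd c u)) (\<xi>, \<eta>)))"
proof -
  interpret differentiable_atlas A using M by (rule smooth_manifold_differentiable_atlas)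
  obtain c' d' where c': "c' \<in> A" "c = slit_chart A c'" and d': "d' \<in> A" "d = slit_chart A d'"
    using c d by (auto simp: slit_atlas_eq)
  have "snd c u \<in> snd c ` (fst c \<inter> fst d)" using u by blast
  then have "snd c u \<in> (snd c' ` (fst c' \<inter> fst d')) \<times> (- {0})"
    using slit_chart_overlap[OF c'(1) d'(1)] c' d' by simp
  moreover have "smooth_on (snd c' ` (fst c' \<inter> fst d')) (snd d' \<circ> cinv c')"
    using M c' d' by (simp add: smooth_manifold_def)
  ultimately obtain L where L: "(snd d \<circ> cinv c has_derivative L) (at (snd c u))"
    "\<forall>\<xi> \<eta>. L (0, \<xi>) = (0, fst (L (\<xi>, \<eta>)))"
    using slit_transition_has_derivative[OF differentiable_atlas_axioms c'(1) d'(1), of "snd c u"]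
    unfolding c'(2) d'(2) by meson
  then show "(snd d \<circ> cinv c) differentiable (at (snd c u))" by (auto simp: differentiable_def)
  show "frechet_derivative (snd d \<circ> cinv c) (at (snd c u)) (0, \<xi>) =
      (0, fst (frechet_derivative (snd d \<circ> cinv c) (at (snd c u)) (\<xi>, \<eta>)))"
    using L(2) frechet_derivative_at[OF L(1)] by simp
qed

lemma slit_differentiable_atlas:
  assumes M: "smooth_manifold M A"
  shows "differentiable_atlas (slit_atlas A)"
proof
  interpret differentiable_atlas A using M by (rule smooth_manifold_differentiable_atlas)
  fix c assume "c \<in> slit_atlas A"
  then obtain c' where c': "c' \<in> A" "c = slit_chart A c'" by (auto simp: slit_atlas_eq)
  then show "inj_on (snd c) (fst c)" using slit_chart_inj by simp
  fix d assume "d \<in> slit_atlas A"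
  then obtain d' where d': "d' \<in> A" "d = slit_chart A d'" by (auto simp: slit_atlas_eq)
  show "open (snd c ` (fst c \<inter> fst d))"
    unfolding c' d' slit_chart_overlap[OF c'(1) d'(1)]
    by (intro open_Times open_overlap c' d') auto
  fix u assume "u \<in> fst c" "u \<in> fst d"
  then show "(snd d \<circ> cinv c) differentiable (at (snd c u))"
    using slit_atlas_transition(1)[OF M] c' d' by (auto simp: slit_atlas_eq)
qed

lemma vert_J_tangent:
  assumes M: "smooth_manifold M A" and w: "w \<in> tangent_space (slit_atlas A) u"
  shows "vert_J w \<in> tangent_space (slit_atlas A) u"
  unfolding tangent_space_def
proof (intro CollectI conjI ballI allI impI)
  fix c d assume cd: "c \<in> slit_atlas A" "d \<in> slit_atlas A" "u \<in> fst c \<inter> fst d"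
  have "w d = frechet_derivative (snd d \<circ> cinv c) (at (snd c u)) (w c)"
    using w cd unfolding tangent_space_def by blast
  then show "vert_J w d = frechet_derivative (snd d \<circ> cinv c) (at (snd c u)) (vert_J w c)"
    using slit_atlas_transition(2)[OF M cd(1,2), of u "fst (w c)" "snd (w c)"] cd(3)
    by (simp add: vert_J_def)
next
  fix c assume "\<not> (c \<in> slit_atlas A \<and> u \<in> fst c)"
  then have "w c = 0" using w unfolding tangent_space_def by blast
  then show "vert_J w c = 0" by (simp add: vert_J_def zero_prod_def)
qed

lemma vert_J_vector_field:
  assumes M: "smooth_manifold M A" and X: "vector_field (slit_atlas A) X"
  shows "vector_field (slit_atlas A) (\<lambda>u. vert_J (X u))"
  unfolding vector_field_def
proof (intro conjI ballI)
  interpret slit: differentiable_atlas "slit_atlas A" using M by (rule slit_differentiable_atlas)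
  show "vert_J (X u) \<in> tangent_space (slit_atlas A) u" if "u \<in> points (slit_atlas A)" for u
    using X that by (intro vert_J_tangent[OF M]) (auto simp: vector_field_def)
  fix c assume c: "c \<in> slit_atlas A"
  have "bounded_linear (\<lambda>w::'b \<times> 'b. (0::'b, fst w))"
    by (intro bounded_linear_Pair bounded_linear_zero bounded_linear_fst)
  from smooth_on_linear[OF slit.open_cimage[OF c] this, of "local_rep X c"]
  show "smooth_on (cimage c) (local_rep (\<lambda>u. vert_J (X u)) c)"
    using X c by (simp add: vector_field_def local_rep_def[abs_def] vert_J_def)
qed

section \<open>The main scalar\<close>

text \<open>The heart of the proof, in one chart, with \<open>m\<close> the main scalar. Put \<open>a = v(\<rho>) = - m \<rho>\<close> and
  \<open>b = h(\<rho>)\<close>. Applying the three brackets to \<open>\<rho>\<close>, where \<open>s(\<rho>) = 0\<close>, gives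
  \<open>s(a) = - b\<close>, \<open>s(b) = \<rho> a\<close> and \<open>h(a) - v(b) = m b + s(m) a\<close>. Since \<open>s(a) = - s(m) \<rho>\<close>, also
  \<open>b = s(m) \<rho>\<close>, hence \<open>h(a) = v(b)\<close>. Applying \<open>[v,s] = h\<close> to \<open>b\<close> and \<open>[s,h] = \<rho> v\<close> to \<open>a\<close> gives
  \<open>a\<^sup>2 + \<rho> v(a) - s(v(b)) = h(b)\<close> and \<open>s(h(a)) + h(b) = \<rho> v(a)\<close>; the sum of the two is \<open>a\<^sup>2 = 0\<close>.\<close>

lemma main_scalar_times_curvature_eq_0:
  fixes h s v :: "'e::euclidean_space \<Rightarrow> 'e" and \<rho> m :: "'e \<Rightarrow> real"
  assumes U: "open U"
    and h: "smooth_on U h" and v: "smooth_on U v" and s: "\<And>z. z \<in> U \<Longrightarrow> s differentiable (at z)"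
    and \<rho>: "smooth_on U \<rho>" and m: "smooth_on U m"
    and sh: "\<And>z. z \<in> U \<Longrightarrow> field_bracket s h z = \<rho> z *\<^sub>R v z"
    and vs: "\<And>z. z \<in> U \<Longrightarrow> field_bracket v s z = h z"
    and hv: "\<And>z. z \<in> U \<Longrightarrow> field_bracket h v z = s z + m z *\<^sub>R h z + field_deriv s m z *\<^sub>R v z"
    and v\<rho>: "\<And>z. z \<in> U \<Longrightarrow> field_deriv v \<rho> z = - m z * \<rho> z"
    and s\<rho>: "\<And>z. z \<in> U \<Longrightarrow> field_deriv s \<rho> z = 0"
    and z: "z \<in> U"
  shows "m z * \<rho> z = 0"
proof -
  note dh = smooth_on_differentiable[OF h] and dv = smooth_on_differentiable[OF v]
  have lin: "linear (frechet_derivative f (at x))" if "smooth_on U f" "x \<in> U" for f :: "'e \<Rightarrow> real" and x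
    using smooth_on_differentiable[OF that] by (rule linear_frechet_derivative)
  have sh': "field_deriv s (field_deriv h f) x - field_deriv h (field_deriv s f) x = \<rho> x * field_deriv v f x"
    if "smooth_on U f" "x \<in> U" for f :: "'e \<Rightarrow> real" and x
    using field_deriv_bracket[OF U that(2,1) s[OF that(2)] dh[OF that(2)]] sh[OF that(2)] lin[OF that]
    by (simp add: field_deriv_def[of "field_bracket _ _"] field_deriv_def[of v] linear_scale)
  have vs': "field_deriv v (field_deriv s f) x - field_deriv s (field_deriv v f) x = field_deriv h f x"
    if "smooth_on U f" "x \<in> U" for f :: "'e \<Rightarrow> real" and x
    using field_deriv_bracket[OF U that(2,1) dv[OF that(2)] s[OF that(2)]] vs[OF that(2)]
    by (simp add: field_deriv_def[of "field_bracket _ _"] field_deriv_def[of h])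
  have hv': "field_deriv h (field_deriv v f) x - field_deriv v (field_deriv h f) x =
      field_deriv s f x + m x * field_deriv h f x + field_deriv s m x * field_deriv v f x"
    if "smooth_on U f" "x \<in> U" for f :: "'e \<Rightarrow> real" and x
    using field_deriv_bracket[OF U that(2,1) dh[OF that(2)] dv[OF that(2)]] hv[OF that(2)] lin[OF that]
    by (simp add: field_deriv_def[of "field_bracket _ _"] linear_scale linear_add)
      (simp add: field_deriv_def)
  have zero: "field_deriv X (field_deriv s \<rho>) x = 0" if "x \<in> U" for X x
  proof -
    have "field_deriv X (\<lambda>x. 0 :: real) x = field_deriv X (field_deriv s \<rho>) x"
      by (rule field_deriv_cong[OF U that]) (simp_all add: s\<rho>)
    then show ?thesis by (simp add: field_deriv_def)
  qed
  define a where "a = field_deriv v \<rho>"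
  define b where "b = field_deriv h \<rho>"
  have sm: "smooth_on U a" "smooth_on U b" "smooth_on U (field_deriv h a)"
    unfolding a_def b_def by (intro smooth_on_field_deriv U h v \<rho>)+
  note da = smooth_on_differentiable[OF sm(1)] and db = smooth_on_differentiable[OF sm(2)]
    and d\<rho> = smooth_on_differentiable[OF \<rho>] and dm = smooth_on_differentiable[OF m]
  have sa: "field_deriv s a x = - b x" if "x \<in> U" for x
    using vs'[OF \<rho> that] zero[OF that] by (simp add: a_def b_def)
  have sb: "field_deriv s b x = \<rho> x * a x" if "x \<in> U" for x
    using sh'[OF \<rho> that] zero[OF that] by (simp add: a_def b_def)
  have b: "b x = field_deriv s m x * \<rho> x" if "x \<in> U" for x
  proof -
    have "field_deriv s a x = field_deriv s (\<lambda>x. (- 1) * (m x * \<rho> x)) x"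
      by (rule field_deriv_cong[OF U that]) (use v\<rho> da that in \<open>simp_all add: a_def\<close>)
    also have "\<dots> = - (field_deriv s m x * \<rho> x)"
      using s\<rho>[OF that] dm[OF that] d\<rho>[OF that]
      by (subst field_deriv_mult) (simp_all add: field_deriv_mult field_deriv_def[of _ "\<lambda>_. - 1"])
    finally show ?thesis using sa[OF that] by simp
  qed
  have hava: "field_deriv h a x = field_deriv v b x" if "x \<in> U" for x
    using hv'[OF \<rho> that] s\<rho>[OF that] b[OF that] v\<rho>[OF that] by (simp add: a_def b_def)
  have "field_deriv v (field_deriv s b) z = field_deriv v (\<lambda>x. \<rho> x * a x) z"
    by (rule field_deriv_cong[OF U z, symmetric]) (use sb d\<rho> da z in \<open>auto intro: differentiable_mult\<close>)
  then have 1: "field_deriv v (field_deriv s b) z = a z * a z + \<rho> z * field_deriv v a z"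
    using field_deriv_mult[OF d\<rho>[OF z] da[OF z], of v] by (simp add: a_def)
  have "field_deriv h (field_deriv s a) z = field_deriv h (\<lambda>x. (- 1) * b x) z"
    by (rule field_deriv_cong[OF U z, symmetric]) (use sa db z in \<open>auto intro: differentiable_minus\<close>)
  then have 2: "field_deriv h (field_deriv s a) z = - field_deriv h b z"
    using field_deriv_mult[of "\<lambda>_. - 1", OF _ db[OF z], of h] by (simp add: field_deriv_def[of _ "\<lambda>_. - 1"])
  have 3: "field_deriv s (field_deriv h a) z = field_deriv s (field_deriv v b) z"
    by (rule field_deriv_cong[OF U z hava smooth_on_differentiable[OF sm(3) z]])
  have "a z * a z = 0"
    using vs'[OF sm(2) z] sh'[OF sm(1) z] 1 2 3 by linarith
  then show ?thesis using v\<rho>[OF z] by (simp add: a_def)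
qed

section \<open>Planar norms with a rotating tangent field\<close>

lemma cubic_form_vanishes_if_first_nonzero:
  fixes A B C D p q x y :: real
  assumes "p * A + q * B = 0" "p * B + q * C = 0" "p * C + q * D = 0"
    and "x ^ 3 * A + 3 * x\<^sup>2 * y * B + 3 * x * y\<^sup>2 * C + y ^ 3 * D = 0"
    and "p * y - q * x \<noteq> 0" "p \<noteq> 0"
  shows "A = 0 \<and> B = 0 \<and> C = 0 \<and> D = 0"
proof -
  have "(p * y - q * x) ^ 3 * D = 0" using assms(1-4) by algebra
  then have D: "D = 0" using assms(5) by simp
  then have "C = 0" using assms(3,6) by simp
  moreover from this have "B = 0" using assms(2,6) by simp
  moreover from this have "A = 0" using assms(1,6) by simp
  ultimately show ?thesis using D by simp
qed

text \<open>The first three hypotheses say that the symmetric cubic form with coefficients \<open>A, B, C, D\<close>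
  is annihilated by contraction with \<open>(p, q)\<close>, hence is a multiple of the cube of the linear form
  \<open>p y - q x\<close>; the fourth evaluates it at a vector independent of \<open>(p, q)\<close>.\<close>

lemma cubic_form_vanishes:
  fixes A B C D p q x y :: real
  assumes "p * A + q * B = 0" "p * B + q * C = 0" "p * C + q * D = 0"
    and "x ^ 3 * A + 3 * x\<^sup>2 * y * B + 3 * x * y\<^sup>2 * C + y ^ 3 * D = 0"
    and "p * y - q * x \<noteq> 0"
  shows "A = 0 \<and> B = 0 \<and> C = 0 \<and> D = 0"
proof (cases "p = 0")
  case True
  then show ?thesis
    using cubic_form_vanishes_if_first_nonzero[of q D p C B A y x] assms by (auto simp: algebra_simps)
qed (use cubic_form_vanishes_if_first_nonzero assms in blast)

text \<open>For a function \<open>l\<close> of degree 2 on the plane, write \<open>l_i\<close>, \<open>l_ij\<close>, \<open>l_ijk\<close> for its partial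
  derivatives. Homogeneity gives \<open>l_ij y_j = l_i\<close> and \<open>l_ijk y_k = 0\<close>. Differentiating \<open>l_i \<xi>_i = 0\<close>
  along \<open>\<xi>\<close> and using \<open>\<xi>(\<xi>) = - y\<close> gives \<open>l_ij \<xi>_i \<xi>_j = 2 l\<close>, and once more
  \<open>l_ijk \<xi>_i \<xi>_j \<xi>_k = 0\<close>. As \<open>y\<close> and \<open>\<xi>\<close> are independent, all third derivatives vanish. The punctured
  plane is connected, so the second derivatives are constant and \<open>l = 1/2 l_ij y_i y_j\<close>.\<close>

lemma quadratic_if_rotating_tangent_field:
  fixes l :: "real^2 \<Rightarrow> real" and \<xi> :: "real^2 \<Rightarrow> real^2"
  assumes l: "smooth_on (- {0}) l"
    and \<xi>: "\<And>y. y \<noteq> 0 \<Longrightarrow> \<xi> differentiable (at y)"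
    and pos: "\<And>y. y \<noteq> 0 \<Longrightarrow> l y > 0"
    and euler: "\<And>y. y \<noteq> 0 \<Longrightarrow> frechet_derivative l (at y) y = 2 * l y"
    and tangent: "\<And>y. y \<noteq> 0 \<Longrightarrow> frechet_derivative l (at y) (\<xi> y) = 0"
    and rotate: "\<And>y. y \<noteq> 0 \<Longrightarrow> frechet_derivative \<xi> (at y) (\<xi> y) = - y"
  shows "\<exists>a::real^2^2. transpose a = a \<and> (\<forall>y. y \<noteq> 0 \<longrightarrow> l y = y \<bullet> (a *v y))"
proof -
  have op: "open (- {0} :: (real^2) set)" by auto
  define p where "p i f y = frechet_derivative f (at y) (axis i 1)" for i :: 2 and f :: "real^2 \<Rightarrow> real" and y
  have sm: "smooth_on (- {0}) (p i f)" if "smooth_on (- {0}) f" for i f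
    unfolding p_def using that by (rule smooth_on_frechet_derivative)
  have commute: "p i (p j f) y = p j (p i f) y" if "smooth_on (- {0}) f" "y \<noteq> 0" for i j f y
    unfolding p_def using second_derivative_commute[OF op _ that(1)] that(2) by simp
  have expand: "w = w $ 1 *\<^sub>R axis 1 1 + w $ 2 *\<^sub>R axis 2 1" for w :: "real^2"
    by (simp add: vec_eq_iff forall_2 axis_def)
  have fd: "frechet_derivative f (at y) w = w $ 1 * p 1 f y + w $ 2 * p 2 f y"
    if "smooth_on (- {0}) f" "y \<noteq> 0" for f y w
  proof -
    have "linear (frechet_derivative f (at y))"
      using smooth_on_differentiable[OF that(1)] that(2) by (simp add: linear_frechet_derivative)
    then show ?thesis
      by (subst expand[of w]) (simp add: p_def linear_add linear_scale)
  qed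
  have hd: "(f has_derivative (\<lambda>w. w $ 1 * p 1 f y + w $ 2 * p 2 f y)) (at y)"
    if "smooth_on (- {0}) f" "y \<noteq> 0" for f y
  proof -
    have "frechet_derivative f (at y) = (\<lambda>w. w $ 1 * p 1 f y + w $ 2 * p 2 f y)"
      by (rule ext) (rule fd[OF that])
    then show ?thesis using smooth_on_has_derivative[OF that(1), of y] that(2) by simp
  qed
  have eq: "f' w = g' w"
    if "\<And>y. y \<noteq> 0 \<Longrightarrow> f y = g y" "(f has_derivative f') (at y)" "(g has_derivative g') (at y)" "y \<noteq> 0"
    for f g :: "real^2 \<Rightarrow> real" and f' g' and y w :: "real^2"
  proof -
    have "(g has_derivative f') (at y)"
      by (rule has_derivative_transform_within_open[OF that(2) op]) (use that in auto)
    then show ?thesis using has_derivative_unique that(3) by metis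
  qed
  define l1 where "l1 = p 1 l"
  define l2 where "l2 = p 2 l"
  define l11 where "l11 = p 1 l1"
  define l12 where "l12 = p 2 l1"
  define l22 where "l22 = p 2 l2"
  \<comment> \<open>The third derivatives \<open>l_111\<close>, \<open>l_112\<close>, \<open>l_122\<close>, \<open>l_222\<close>.\<close>
  define A where "A = p 1 l11"
  define B where "B = p 2 l11"
  define C where "C = p 2 l12"
  define D where "D = p 2 l22"
  have s1: "smooth_on (- {0}) l1" "smooth_on (- {0}) l2" unfolding l1_def l2_def by (intro sm l)+
  have s2: "smooth_on (- {0}) l11" "smooth_on (- {0}) l12" "smooth_on (- {0}) l22"
    unfolding l11_def l12_def l22_def by (intro sm s1)+
  have c12: "p 1 l2 y = l12 y" if "y \<noteq> 0" for y
    unfolding l12_def l1_def l2_def using commute[OF l that] .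
  have cB: "p 1 l12 y = B y" if "y \<noteq> 0" for y
    unfolding B_def l11_def l12_def using commute[OF s1(1) that] .
  have cC: "p 1 l22 y = C y" if "y \<noteq> 0" for y
  proof -
    have "p 1 l22 y = p 2 (p 1 l2) y" unfolding l22_def using commute[OF s1(2) that] .
    also have "\<dots> = p 2 l12 y"
      unfolding p_def[of 2] 
      by (rule fun_cong[OF frechet_derivative_transform_within_open[OF _ op]])
        (use that c12 smooth_on_differentiable[OF sm[OF s1(2)]] in auto)
    finally show ?thesis by (simp add: C_def)
  qed
  have H: "(l has_derivative (\<lambda>w. w $ 1 * l1 y + w $ 2 * l2 y)) (at y)"
    "(l1 has_derivative (\<lambda>w. w $ 1 * l11 y + w $ 2 * l12 y)) (at y)"
    "(l2 has_derivative (\<lambda>w. w $ 1 * l12 y + w $ 2 * l22 y)) (at y)"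
    "(l11 has_derivative (\<lambda>w. w $ 1 * A y + w $ 2 * B y)) (at y)"
    "(l12 has_derivative (\<lambda>w. w $ 1 * B y + w $ 2 * C y)) (at y)"
    "(l22 has_derivative (\<lambda>w. w $ 1 * C y + w $ 2 * D y)) (at y)" if "y \<noteq> 0" for y
    using hd[OF l that] hd[OF s1(1) that] hd[OF s1(2) that] hd[OF s2(1) that] hd[OF s2(2) that] hd[OF s2(3) that]
      c12[OF that] cB[OF that] cC[OF that]
    by (simp_all only: l1_def l2_def l11_def l12_def l22_def A_def B_def C_def D_def)
  have nth: "((\<lambda>y. y $ i) has_derivative (\<lambda>w. w $ i)) (at y)" for i :: 2 and y :: "real^2"
    by (rule bounded_linear.has_derivative[OF bounded_linear_vec_nth has_derivative_ident])
  have \<xi>d: "((\<lambda>y. \<xi> y $ i) has_derivative (\<lambda>w. frechet_derivative \<xi> (at y) w $ i)) (at y)" if "y \<noteq> 0" for i y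
    using \<xi>[OF that] frechet_derivative_works
    by (intro bounded_linear.has_derivative[OF bounded_linear_vec_nth]) auto
  \<comment> \<open>The Euler relation for \<open>l\<close>, and its first and second derivatives.\<close>
  have E0: "y $ 1 * l1 y + y $ 2 * l2 y = 2 * l y" if "y \<noteq> 0" for y
    using euler[OF that] fd[OF l that] by (simp add: l1_def l2_def)
  have E1: "w $ 1 * l1 y + y $ 1 * (w $ 1 * l11 y + w $ 2 * l12 y) +
      (w $ 2 * l2 y + y $ 2 * (w $ 1 * l12 y + w $ 2 * l22 y)) = 2 * (w $ 1 * l1 y + w $ 2 * l2 y)"
    if "y \<noteq> 0" for y w :: "real^2"
    by (rule eq[OF E0, where y = y and w = w and f' = "\<lambda>w. w $ 1 * l1 y + y $ 1 * (w $ 1 * l11 y + w $ 2 * l12 y) +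
      (w $ 2 * l2 y + y $ 2 * (w $ 1 * l12 y + w $ 2 * l22 y))" and g' = "\<lambda>w. 2 * (w $ 1 * l1 y + w $ 2 * l2 y)"])
      (auto intro!: derivative_eq_intros H nth that)
  have E1a: "y $ 1 * l11 y + y $ 2 * l12 y = l1 y" and E1b: "y $ 1 * l12 y + y $ 2 * l22 y = l2 y" if "y \<noteq> 0" for y
    using E1[OF that, of "axis 1 1"] E1[OF that, of "axis 2 1"] by (simp_all add: axis_def)
  have E2: "w $ 1 * l11 y + y $ 1 * (w $ 1 * A y + w $ 2 * B y) +
      (w $ 2 * l12 y + y $ 2 * (w $ 1 * B y + w $ 2 * C y)) = w $ 1 * l11 y + w $ 2 * l12 y"
    if "y \<noteq> 0" for y w :: "real^2"
    by (rule eq[OF E1a, where y = y and w = w and f' = "\<lambda>w. w $ 1 * l11 y + y $ 1 * (w $ 1 * A y + w $ 2 * B y) +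
      (w $ 2 * l12 y + y $ 2 * (w $ 1 * B y + w $ 2 * C y))" and g' = "\<lambda>w. w $ 1 * l11 y + w $ 2 * l12 y"])
      (auto intro!: derivative_eq_intros H nth that)
  have E3: "w $ 1 * l12 y + y $ 1 * (w $ 1 * B y + w $ 2 * C y) +
      (w $ 2 * l22 y + y $ 2 * (w $ 1 * C y + w $ 2 * D y)) = w $ 1 * l12 y + w $ 2 * l22 y"
    if "y \<noteq> 0" for y w :: "real^2"
    by (rule eq[OF E1b, where y = y and w = w and f' = "\<lambda>w. w $ 1 * l12 y + y $ 1 * (w $ 1 * B y + w $ 2 * C y) +
      (w $ 2 * l22 y + y $ 2 * (w $ 1 * C y + w $ 2 * D y))" and g' = "\<lambda>w. w $ 1 * l12 y + w $ 2 * l22 y"])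
      (auto intro!: derivative_eq_intros H nth that)
  \<comment> \<open>Tangency of \<open>\<xi>\<close>, and its first and second derivatives along \<open>\<xi>\<close>.\<close>
  have T0: "\<xi> y $ 1 * l1 y + \<xi> y $ 2 * l2 y = 0" if "y \<noteq> 0" for y
    using tangent[OF that] fd[OF l that] by (simp add: l1_def l2_def)
  have T1: "(\<xi> y $ 1)\<^sup>2 * l11 y + 2 * (\<xi> y $ 1 * \<xi> y $ 2 * l12 y) + (\<xi> y $ 2)\<^sup>2 * l22 y = 2 * l y"
    if "y \<noteq> 0" for y
  proof -
    let ?d = "\<lambda>w i. frechet_derivative \<xi> (at y) w $ i"
    let ?l = "\<lambda>w. ?d w 1 * l1 y + \<xi> y $ 1 * (w $ 1 * l11 y + w $ 2 * l12 y) +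
      (?d w 2 * l2 y + \<xi> y $ 2 * (w $ 1 * l12 y + w $ 2 * l22 y))"
    let ?r = "\<lambda>w :: real^2. 0"
    have "?l (\<xi> y) = ?r (\<xi> y)"
      by (rule eq[OF T0, where f' = ?l and g' = ?r and y = y])
        (auto intro!: derivative_eq_intros H \<xi>d that)
    then show ?thesis
      using E0[OF that] by (simp add: rotate[OF that] power2_eq_square algebra_simps)
  qed
  have T2: "(\<xi> y $ 1) ^ 3 * A y + 3 * (\<xi> y $ 1)\<^sup>2 * \<xi> y $ 2 * B y + 3 * \<xi> y $ 1 * (\<xi> y $ 2)\<^sup>2 * C y
      + (\<xi> y $ 2) ^ 3 * D y = 0" if "y \<noteq> 0" for y
  proof -
    let ?d = "\<lambda>w i. frechet_derivative \<xi> (at y) w $ i"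
    let ?l = "\<lambda>w. 2 * \<xi> y $ 1 * ?d w 1 * l11 y + (\<xi> y $ 1)\<^sup>2 * (w $ 1 * A y + w $ 2 * B y) +
        2 * ((?d w 1 * \<xi> y $ 2 + \<xi> y $ 1 * ?d w 2) * l12 y + \<xi> y $ 1 * \<xi> y $ 2 * (w $ 1 * B y + w $ 2 * C y)) +
        (2 * \<xi> y $ 2 * ?d w 2 * l22 y + (\<xi> y $ 2)\<^sup>2 * (w $ 1 * C y + w $ 2 * D y))"
    let ?r = "\<lambda>w :: real^2. 2 * (w $ 1 * l1 y + w $ 2 * l2 y)"
    have "?l (\<xi> y) = ?r (\<xi> y)"
      by (rule eq[OF T1, where f' = ?l and g' = ?r and y = y])
        (auto intro!: derivative_eq_intros H \<xi>d that simp: algebra_simps)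
    then have "(\<xi> y $ 1) ^ 3 * A y + 3 * (\<xi> y $ 1)\<^sup>2 * \<xi> y $ 2 * B y + 3 * \<xi> y $ 1 * (\<xi> y $ 2)\<^sup>2 * C y
      + (\<xi> y $ 2) ^ 3 * D y = 2 * (\<xi> y $ 1 * l1 y + \<xi> y $ 2 * l2 y)
        + 2 * \<xi> y $ 1 * (y $ 1 * l11 y + y $ 2 * l12 y) + 2 * \<xi> y $ 2 * (y $ 1 * l12 y + y $ 2 * l22 y)"
      by (simp add: rotate[OF that] power2_eq_square power3_eq_cube algebra_simps)
    then show ?thesis
      unfolding E1a[OF that] E1b[OF that] using T0[OF that] by algebra
  qed
  \<comment> \<open>If \<open>\<xi> = c y\<close>, then \<open>0 = c (2 l)\<close> forces \<open>\<xi> = 0\<close>, which contradicts \<open>\<xi>(\<xi>) = - y\<close>.\<close>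
  have indep: "y $ 1 * \<xi> y $ 2 - y $ 2 * \<xi> y $ 1 \<noteq> 0" if "y \<noteq> 0" for y
  proof
    assume d: "y $ 1 * \<xi> y $ 2 - y $ 2 * \<xi> y $ 1 = 0"
    have "\<xi> y $ 1 * (2 * l y) = 0" "\<xi> y $ 2 * (2 * l y) = 0"
      using d E0[OF that] T0[OF that] by algebra+
    then have "\<xi> y = 0" using pos[OF that] by (simp add: vec_eq_iff forall_2)
    then have "frechet_derivative \<xi> (at y) 0 = - y" using rotate[OF that] by simp
    moreover have "frechet_derivative \<xi> (at y) 0 = 0"
      using \<xi>[OF that] by (intro linear_0 linear_frechet_derivative)
    ultimately show False using that by simp
  qed
  have ABCD: "A y = 0 \<and> B y = 0 \<and> C y = 0 \<and> D y = 0" if "y \<noteq> 0" for y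
  proof (rule cubic_form_vanishes)
    show "y $ 1 * A y + y $ 2 * B y = 0" using E2[OF that, of "axis 1 1"] by (simp add: axis_def)
    show "y $ 1 * B y + y $ 2 * C y = 0" using E2[OF that, of "axis 2 1"] by (simp add: axis_def)
    show "y $ 1 * C y + y $ 2 * D y = 0" using E3[OF that, of "axis 2 1"] by (simp add: axis_def)
  qed (use T2[OF that] indep[OF that] in auto)
  have const: "f y = f (axis 1 1)" if "\<And>y. y \<noteq> 0 \<Longrightarrow> (f has_derivative (\<lambda>w. 0)) (at y)" "y \<noteq> 0"
    for f :: "real^2 \<Rightarrow> real" and y
  proof (rule has_derivative_zero_unique_connected[OF op])
    show "connected (- {0} :: (real^2) set)" by (rule connected_punctured_universe) simp
  qed (use that in \<open>auto simp: axis_eq_0_iff\<close>)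
  have K: "l11 y = l11 (axis 1 1)" "l12 y = l12 (axis 1 1)" "l22 y = l22 (axis 1 1)" if "y \<noteq> 0" for y
    using H(4-6) ABCD that by (auto intro!: const)
  define a :: "real^2^2" where
    "a = (\<chi> i j. (if i = j then (if i = 1 then l11 (axis 1 1) else l22 (axis 1 1)) else l12 (axis 1 1)) / 2)"
  have "l y = y \<bullet> (a *v y)" if "y \<noteq> 0" for y
  proof -
    have "2 * l y = y $ 1 * (y $ 1 * l11 y + y $ 2 * l12 y) + y $ 2 * (y $ 1 * l12 y + y $ 2 * l22 y)"
      using E0[OF that] E1a[OF that] E1b[OF that] by simp
    then show ?thesis
      by (simp add: a_def K[OF that] inner_vec_def sum_2 matrix_vector_mult_def algebra_simps)
  qed
  moreover have "transpose a = a" by (simp add: a_def transpose_def vec_eq_iff forall_2)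
  ultimately show ?thesis by blast
qed

section \<open>Regularity of the geodesic spray\<close>

text \<open>Cramer's rule expresses the product by quotients of polynomials in the entries.\<close>

lemma differentiable_matrix_inv_vector_mult:
  fixes g :: "'a::real_normed_vector \<Rightarrow> real^2^2" and b :: "'a \<Rightarrow> real^2"
  assumes U: "open U" "z \<in> U"
    and g: "\<And>i j. (\<lambda>z. g z $ i $ j) differentiable (at z)"
    and b: "\<And>i. (\<lambda>z. b z $ i) differentiable (at z)"
    and rank: "\<And>z. z \<in> U \<Longrightarrow> rank (g z) = 2"
  shows "(\<lambda>z. matrix_inv (g z) *v b z) differentiable (at z)"
proof -
  \<comment> \<open>The numerators in Cramer's rule.\<close>
  define num :: "'a \<Rightarrow> real^2" where "num z = (\<chi> k. if k = 1 then b z $ 1 * g z $ 2 $ 2 - g z $ 1 $ 2 * b z $ 2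
    else g z $ 1 $ 1 * b z $ 2 - b z $ 1 * g z $ 2 $ 1)" for z
  have det: "det (g z) \<noteq> 0" if "z \<in> U" for z
  proof -
    have "inj ((*v) (g z))" using rank[OF that] full_rank_injective[of "g z"] by simp
    then show ?thesis
      by (simp add: invertible_det_nz[symmetric] invertible_left_inverse matrix_left_invertible_injective)
  qed
  have eq: "(1 / det (g z)) *\<^sub>R num z = matrix_inv (g z) *v b z" if "z \<in> U" for z
  proof -
    have "g z ** matrix_inv (g z) = mat 1"
      using det[OF that] someI_ex[of "\<lambda>B. g z ** B = mat 1 \<and> B ** g z = mat 1"]
      unfolding matrix_inv_def invertible_det_nz[symmetric] invertible_def by blast
    then have "g z *v (matrix_inv (g z) *v b z) = b z"
      by (simp add: matrix_vector_mul_assoc)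
    then show ?thesis
      using det[OF that] cramer[of "g z" "matrix_inv (g z) *v b z" "b z"]
      by (simp add: num_def vec_eq_iff forall_2 det_2)
  qed
  have "(\<lambda>z. (1 / det (g z)) *\<^sub>R num z) differentiable (at z)"
  proof (rule differentiable_scaleR)
    show "(\<lambda>z. 1 / det (g z)) differentiable (at z)"
      using det[OF U(2)] g by (intro differentiable_divide) (auto simp: det_2)
    have "(\<lambda>z. num z $ k) differentiable (at z)" for k
      using g b by (cases "k = 1") (auto simp: num_def)
    then show "num differentiable (at z)"
      by (subst differentiable_componentwise_within) (auto simp: Basis_vec_def inner_axis)
  qed
  then show ?thesis
    by (rule differentiable_transform_open[OF _ U eq])
qed

lemma finsler_smooth:
  assumes "smooth_manifold M A" "finsler_function A F" "c \<in> slit_atlas A"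
  shows "smooth_on (cimage c) (F \<circ> cinv c)" "smooth_on (cimage c) (Fsq F c)"
proof -
  interpret slit: differentiable_atlas "slit_atlas A" using assms(1) by (rule slit_differentiable_atlas)
  show F: "smooth_on (cimage c) (F \<circ> cinv c)"
    using assms(2,3) by (simp add: finsler_function_def smooth_function_def)
  have "Fsq F c = (\<lambda>z. (F \<circ> cinv c) z * (F \<circ> cinv c) z)"
    by (simp add: Fsq_def fun_eq_iff power2_eq_square)
  then show "smooth_on (cimage c) (Fsq F c)"
    using smooth_on_mult[OF slit.open_cimage[OF assms(3)] F F] by simp
qed

text \<open>Needed to apply brackets with the spray to functions. The nondegeneracy of the metric enters
  here.\<close>

lemma spray_comps_differentiable:
  assumes M: "smooth_manifold M A" and F: "finsler_function A F"
    and c: "c \<in> slit_atlas A" and z: "z \<in> cimage c"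
  shows "spray_comps F c differentiable (at z)"
proof -
  interpret slit: differentiable_atlas "slit_atlas A" using M by (rule slit_differentiable_atlas)
  have L: "smooth_on (cimage c) (Fsq F c)" using finsler_smooth[OF M F c] by simp
  have dx: "smooth_on (cimage c) (dx i f)" and dy: "smooth_on (cimage c) (dy i f)"
    if "smooth_on (cimage c) f" for i f
    unfolding dx_def[abs_def] dy_def[abs_def] using that by (simp_all add: smooth_on_frechet_derivative)
  note diff = smooth_on_differentiable[OF _ z]
  have nth: "(\<lambda>z. snd z $ k) differentiable (at z)" for k :: 2 and z :: "(real^2) \<times> (real^2)"
    by (rule bounded_linear_imp_differentiable)
      (rule bounded_linear_compose[OF bounded_linear_vec_nth bounded_linear_snd])
  have "(\<lambda>z. matrix_inv (metric F c z) *v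
     (\<chi> j. (\<Sum>k\<in>UNIV. (snd z $ k) * dx k (dy j (Fsq F c)) z) - dx j (Fsq F c) z)) differentiable (at z)"
  proof (rule differentiable_matrix_inv_vector_mult[OF slit.open_cimage[OF c] z])
    show "(\<lambda>z. metric F c z $ i $ j) differentiable (at z)" for i j
      using diff[OF dy[OF dy[OF L]]] by (simp add: metric_def)
    show "(\<lambda>z. (\<chi> j. (\<Sum>k\<in>UNIV. (snd z $ k) * dx k (dy j (Fsq F c)) z) - dx j (Fsq F c) z) $ i)
        differentiable (at z)" for i
      using diff[OF dx[OF dy[OF L]]] diff[OF dx[OF L]] nth by simp
    show "rank (metric F c z) = 2" if "z \<in> cimage c" for z
      using F c that by (simp add: finsler_function_def)
  qed
  then have "spray_coeff F c differentiable (at z)"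
    unfolding spray_coeff_def[abs_def] by simp
  moreover have "snd differentiable (at z)"
    by (rule bounded_linear_imp_differentiable) (rule bounded_linear_snd)
  ultimately show ?thesis unfolding spray_comps_def[abs_def] by simp
qed

section \<open>Nonflat Finsler surfaces\<close>

lemma slit_chart_subset: "c \<in> slit_atlas A \<Longrightarrow> fst c \<subseteq> slit A"
  by (auto simp: slit_atlas_def)

lemma euler_degree_2:
  fixes l :: "'a::real_normed_vector \<Rightarrow> real"
  assumes "l differentiable (at y)" and hom: "\<And>t. t > 0 \<Longrightarrow> l (t *\<^sub>R y) = t\<^sup>2 * l y"
  shows "frechet_derivative l (at y) y = 2 * l y"
proof -
  have "((\<lambda>t. l (t *\<^sub>R y)) has_derivative (\<lambda>d. frechet_derivative l (at y) (d *\<^sub>R y))) (at 1)"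
    by (rule has_derivative_compose[where g = l and f = "\<lambda>t. t *\<^sub>R y"])
      (use frechet_derivative_works[THEN iffD1, OF assms(1)] in \<open>auto intro!: derivative_eq_intros\<close>)
  then have "((\<lambda>t. t\<^sup>2 * l y) has_derivative (\<lambda>d. frechet_derivative l (at y) (d *\<^sub>R y))) (at 1)"
    by (rule has_derivative_transform_within_open[where s = "{0<..}"]) (simp_all add: hom)
  moreover have "((\<lambda>t. t\<^sup>2 * l y) has_derivative (\<lambda>d. 2 * d * l y)) (at 1)"
    by (auto intro!: derivative_eq_intros)
  ultimately have "(\<lambda>d. frechet_derivative l (at y) (d *\<^sub>R y)) = (\<lambda>d. 2 * d * l y)"
    by (rule has_derivative_unique)
  from fun_cong[OF this, of 1] show ?thesis by simp
qed

text \<open>Positive homogeneity of a Finsler function is a statement about scaled tangent vectors, and these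
  have to be slit tangent vectors again for their coordinates to be computed in a chart.\<close>

lemma slit_scale:
  assumes A: "differentiable_atlas A" and u: "(p, v) \<in> slit A" and t: "t > 0"
  shows "(p, \<lambda>c. t *\<^sub>R v c) \<in> slit A"
proof -
  interpret differentiable_atlas A by fact
  have v: "v \<in> tangent_space A p" "p \<in> points A" "v \<noteq> (\<lambda>_. 0)"
    using u by (auto simp: slit_def tangent_bundle_def)
  have lin: "linear (frechet_derivative (snd d \<circ> cinv c) (at (snd c p)))"
    if "c \<in> A" "d \<in> A" "p \<in> fst c" "p \<in> fst d" for c d
    using transition[OF that] by (rule linear_frechet_derivative)
  have "t *\<^sub>R v d = frechet_derivative (snd d \<circ> cinv c) (at (snd c p)) (t *\<^sub>R v c)"
    if "c \<in> A" "d \<in> A" "p \<in> fst c \<inter> fst d" for c d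
    using that tangent_vector_change_chart[OF v(1), of c d] lin[of c d] by (simp add: linear_scale)
  moreover have "t *\<^sub>R v c = 0" if "\<not> (c \<in> A \<and> p \<in> fst c)" for c
  proof -
    have "v c = 0" using v(1) that unfolding tangent_space_def by blast
    then show ?thesis by simp
  qed
  ultimately have "(\<lambda>c. t *\<^sub>R v c) \<in> tangent_space A p"
    unfolding tangent_space_def by blast
  moreover have "(\<lambda>c. t *\<^sub>R v c) \<noteq> (\<lambda>_. 0)" using v(3) t by (auto simp: fun_eq_iff)
  ultimately show ?thesis using v by (simp add: slit_def tangent_bundle_def)
qed

theorem theorem5p11:
  fixes M :: "'p topology" and A :: "('p, real^2) chart set"
    and F K I :: "('p, real^2) tvec \<Rightarrow> real"
    and H V :: "(('p, real^2) tvec, (real^2) \<times> (real^2)) vfield"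
  assumes "smooth_manifold M A"
    and "finsler_function A F"
    and "flag_curvature A F K"
    and nonflat: "\<forall>u\<in>slit A. K u \<noteq> 0"
    and "berwald_frame A F K H V I"
    and "\<forall>u\<in>slit A. vf_apply (slit_atlas A) V (ricci_scalar F K) u = - I u * ricci_scalar F K u"
    and "\<forall>u\<in>slit A. vf_apply (slit_atlas A) (geodesic_spray A F) (ricci_scalar F K) u = 0"
  shows "riemannian A F"
proof -
  note M = assms(1) and F = assms(2)
  interpret base: differentiable_atlas A using M by (rule smooth_manifold_differentiable_atlas)
  interpret slit: differentiable_atlas "slit_atlas A" using M by (rule slit_differentiable_atlas)
  define S where "S = geodesic_spray A F"
  define \<rho> where "\<rho> = ricci_scalar F K"
  have frame: "vector_field (slit_atlas A) H" "smooth_function (slit_atlas A) I"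
    "\<And>u. u \<in> slit A \<Longrightarrow> d_J A F u (H u) = 0" "V = (\<lambda>u. vert_J (H u))"
    "\<And>u c. u \<in> slit A \<Longrightarrow> lie_bracket (slit_atlas A) S H u c = \<rho> u *\<^sub>R V u c"
    "\<And>u. u \<in> slit A \<Longrightarrow> lie_bracket (slit_atlas A) V S u = H u"
    "\<And>u c. u \<in> slit A \<Longrightarrow> lie_bracket (slit_atlas A) H V u c =
       S u c + I u *\<^sub>R H u c + vf_apply (slit_atlas A) S I u *\<^sub>R V u c"
    using assms(5) unfolding berwald_frame_def S_def \<rho>_def by (auto simp: Let_def)
  have Vf: "vector_field (slit_atlas A) V"
    unfolding frame(4) by (rule vert_J_vector_field[OF M frame(1)])
  have Fpos: "F u > 0" if "u \<in> slit A" for u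
    using F that by (simp add: finsler_function_def)
  have S_chart: "local_rep S c z = spray_comps F c z" if "c \<in> slit_atlas A" "z \<in> cimage c" for c z
    using that chart_cinv[OF that(2)] by (simp add: S_def local_rep_def geodesic_spray_def field_of_comps_def)
  have \<rho>: "smooth_function (slit_atlas A) \<rho>"
    unfolding smooth_function_def
  proof
    fix c assume c: "c \<in> slit_atlas A"
    have "smooth_on (cimage c) (K \<circ> cinv c)"
      using assms(3) c by (simp add: flag_curvature_def smooth_function_def)
    from smooth_on_mult[OF slit.open_cimage[OF c] this finsler_smooth(2)[OF M F c]]
    show "smooth_on (cimage c) (\<rho> \<circ> cinv c)"
      by (simp add: \<rho>_def ricci_scalar_def Fsq_def o_def)
  qed
  have S_apply: "vf_apply (slit_atlas A) S f (cinv c z) = field_deriv (local_rep S c) (f \<circ> cinv c) z"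
    if "smooth_function (slit_atlas A) f" "c \<in> slit_atlas A" "z \<in> cimage c" for f c z
  proof (rule slit.bracket_combination_in_chart[OF frame(1) Vf that(1) _ that(2,3)])
    show "lie_bracket (slit_atlas A) H V u c =
        S u c + I u *\<^sub>R H u c + vf_apply (slit_atlas A) S I u *\<^sub>R V u c"
      if "c \<in> slit_atlas A" "u \<in> fst c" for u c
      using frame(7) slit_chart_subset[OF that(1)] that(2) by blast
  qed
  have in_slit: "cinv c z \<in> slit A" if "c \<in> slit_atlas A" "z \<in> cimage c" for c z
    using slit_chart_subset[OF that(1)] chart_cinv(1)[OF that(2)] by (rule subsetD)
  \<comment> \<open>Here the Landsberg scalar \<open>S(I)\<close>, which is evaluated in some chart, becomes the derivative in the given one.\<close>
  have bracket: "field_bracket (local_rep H c) (local_rep V c) z =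
      local_rep S c z + (I \<circ> cinv c) z *\<^sub>R local_rep H c z
      + field_deriv (local_rep S c) (I \<circ> cinv c) z *\<^sub>R local_rep V c z"
    if c: "c \<in> slit_atlas A" "z \<in> cimage c" for c z
    using frame(7)[OF in_slit[OF c], of c] slit.lie_bracket_in_chart[OF c, of H V] S_apply[OF frame(2) c]
    by (simp add: local_rep_def)
  have I0: "I u = 0" if "u \<in> slit A" for u
  proof -
    have "fst u \<in> points A" using that by (auto simp: slit_def tangent_bundle_def)
    then obtain c0 where c0: "c0 \<in> A" "fst u \<in> fst c0" unfolding points_def by blast
    define c where "c = slit_chart A c0"
    have c: "c \<in> slit_atlas A" "u \<in> fst c"
      using that c0 by (simp_all add: c_def slit_atlas_eq slit_chart_def)
    have "(I \<circ> cinv c) (snd c u) * (\<rho> \<circ> cinv c) (snd c u) = 0"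
    proof (rule main_scalar_times_curvature_eq_0[OF slit.open_cimage[OF c(1)], where s = "local_rep S c"
          and h = "local_rep H c" and v = "local_rep V c"])
      show "smooth_on (cimage c) (local_rep H c)" "smooth_on (cimage c) (local_rep V c)"
        "smooth_on (cimage c) (\<rho> \<circ> cinv c)" "smooth_on (cimage c) (I \<circ> cinv c)"
        using frame(1,2) Vf \<rho> c(1) by (simp_all add: vector_field_def smooth_function_def)
      show "snd c u \<in> cimage c" using c by (simp add: in_cimage)
      fix z assume z: "z \<in> cimage c"
      show "local_rep S c differentiable at z"
        by (rule differentiable_transform_open[OF spray_comps_differentiable[OF M F c(1) z] slit.open_cimage[OF c(1)] z])
          (simp add: S_chart c(1))
      show "field_bracket (local_rep S c) (local_rep H c) z = (\<rho> \<circ> cinv c) z *\<^sub>R local_rep V c z"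
        using frame(5)[OF in_slit[OF c(1) z], of c] slit.lie_bracket_in_chart[OF c(1) z, of S H]
        by (simp add: local_rep_def)
      show "field_bracket (local_rep V c) (local_rep S c) z = local_rep H c z"
        using frame(6)[OF in_slit[OF c(1) z]] slit.lie_bracket_in_chart[OF c(1) z, of V S]
        by (simp add: local_rep_def)
      show "field_deriv (local_rep V c) (\<rho> \<circ> cinv c) z = - (I \<circ> cinv c) z * (\<rho> \<circ> cinv c) z"
        using assms(6) in_slit[OF c(1) z] slit.vf_apply_in_chart[OF \<rho> Vf c(1) z] by (simp add: \<rho>_def)
      show "field_deriv (local_rep S c) (\<rho> \<circ> cinv c) z = 0"
        using assms(7) in_slit[OF c(1) z] S_apply[OF \<rho> c(1) z] by (simp add: \<rho>_def S_def)
    qed (rule bracket[OF c(1)])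
    then have "I u * \<rho> u = 0" using c by (simp add: slit.cinv_chart)
    moreover have "\<rho> u \<noteq> 0" using nonflat Fpos[OF that] that by (simp add: \<rho>_def ricci_scalar_def)
    ultimately show ?thesis by simp
  qed

  show ?thesis
    unfolding riemannian_def
  proof (intro ballI)
    fix c0 p assume c0: "c0 \<in> A" and p: "p \<in> fst c0"
    define c where "c = slit_chart A c0"
    define x where "x = snd c0 p"
    \<comment> \<open>From here on \<open>p\<close> is fixed, and everything takes place in the fibre over \<open>p\<close>.\<close>
    define l where "l y = Fsq F c (x, y)" for y
    define \<xi> where "\<xi> y = fst (local_rep H c (x, y))" for y
    have c: "c \<in> slit_atlas A" using c0 by (simp add: slit_atlas_eq c_def)
    have xy: "(x, y) \<in> cimage c \<longleftrightarrow> y \<noteq> 0" for y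
      unfolding c_def base.cimage_slit_chart[OF c0] using p by (simp add: x_def in_cimage)
    have L: "smooth_on (cimage c) (Fsq F c)" and Fc: "smooth_on (cimage c) (F \<circ> cinv c)"
      using finsler_smooth[OF M F c] by auto
    have h: "smooth_on (cimage c) (local_rep H c)" using frame(1) c by (simp add: vector_field_def)
    have incl: "((\<lambda>y. (x, y)) has_derivative (\<lambda>w. (0, w))) (at y)" for y
      by (auto intro!: derivative_eq_intros)
    have V_chart: "local_rep V c z = (0, fst (local_rep H c z))" for z
      by (simp add: frame(4) local_rep_def vert_J_def)
    have dl: "(l has_derivative (\<lambda>w. frechet_derivative (Fsq F c) (at (x, y)) (0, w))) (at y)" if "y \<noteq> 0" for y
      unfolding l_def
      by (rule has_derivative_compose[OF incl smooth_on_has_derivative[OF L]]) (simp add: xy that)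
    have d\<xi>: "(\<xi> has_derivative (\<lambda>w. fst (frechet_derivative (local_rep H c) (at (x, y)) (0, w)))) (at y)"
      if "y \<noteq> 0" for y
      unfolding \<xi>_def
      by (rule has_derivative_fst[OF has_derivative_compose[OF incl smooth_on_has_derivative[OF h]]])
        (simp add: xy that)
    have point: "snd c (p, v) = (x, v c0)" "cinv c (x, v c0) = (p, v)" if "(p, v) \<in> slit A" for v
    proof -
      have "(p, v) \<in> fst c" using that p by (simp add: c_def slit_chart_def)
      then show "snd c (p, v) = (x, v c0)" "cinv c (x, v c0) = (p, v)"
        using slit.cinv_chart[OF c, of "(p, v)"] by (simp_all add: c_def slit_chart_def x_def)
    qed
    have ex_point: "\<exists>v. (p, v) \<in> slit A \<and> v c0 = y" if "y \<noteq> 0" for y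
    proof -
      obtain v where "v \<in> tangent_space A p" "v c0 = y" using base.tangent_vector_exists[OF c0 p] .
      then show ?thesis using that c0 p by (auto simp: slit_def tangent_bundle_def points_def)
    qed
    have "\<exists>a. transpose a = a \<and> (\<forall>y. y \<noteq> 0 \<longrightarrow> l y = y \<bullet> (a *v y))"
    proof (rule quadratic_if_rotating_tangent_field[where \<xi> = \<xi>])
      show "smooth_on (- {0}) l"
        unfolding l_def
        by (rule smooth_on_affine_comp[OF slit.open_cimage[OF c] _ incl _ L]) (auto simp: xy)
      fix y :: "real^2" assume y: "y \<noteq> 0"
      let ?z = "(x, y)"
      have z: "?z \<in> cimage c" using xy y by simp
      note u = in_slit[OF c z]
      have dl': "frechet_derivative l (at y) = (\<lambda>w. frechet_derivative (Fsq F c) (at ?z) (0, w))"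
        using frechet_derivative_at[OF dl[OF y]] by simp
      have d\<xi>': "frechet_derivative \<xi> (at y) = (\<lambda>w. fst (frechet_derivative (local_rep H c) (at ?z) (0, w)))"
        using frechet_derivative_at[OF d\<xi>[OF y]] by simp
      show "\<xi> differentiable (at y)" using d\<xi>[OF y] by (auto simp: differentiable_def)
      show "l y > 0" using Fpos[OF u] by (simp add: l_def Fsq_def)
      show "frechet_derivative l (at y) y = 2 * l y"
      proof (rule euler_degree_2)
        show "l differentiable (at y)" using dl[OF y] by (auto simp: differentiable_def)
        fix t :: real assume t: "t > 0"
        obtain v where v: "(p, v) \<in> slit A" "v c0 = y" using ex_point[OF y] by blast
        have "(p, \<lambda>c. t *\<^sub>R v c) \<in> slit A"
          using slit_scale[OF base.differentiable_atlas_axioms v(1) t] .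
        moreover have "F (p, \<lambda>c. t *\<^sub>R v c) = t * F (p, v)"
          using F t v(1) by (auto simp: finsler_function_def slit_def)
        ultimately show "l (t *\<^sub>R y) = t\<^sup>2 * l y"
          using point(2)[OF v(1)] point(2)[of "\<lambda>c. t *\<^sub>R v c"] v(2)
          by (simp add: l_def Fsq_def power_mult_distrib)
      qed
      have "vf_apply (slit_atlas A) V F (cinv c ?z) = 0"
        using frame(3)[OF u] by (simp add: vf_apply_def d_J_def frame(4))
      then have VF: "field_deriv (local_rep V c) (F \<circ> cinv c) ?z = 0"
        using slit.vf_apply_in_chart[OF _ Vf c z, of F] F by (simp add: finsler_function_def)
      have "field_deriv (local_rep V c) (\<lambda>z. (F \<circ> cinv c) z * (F \<circ> cinv c) z) ?z = 0"
        using field_deriv_mult[OF smooth_on_differentiable[OF Fc z] smooth_on_differentiable[OF Fc z],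
            of "local_rep V c"] VF by simp
      moreover have "(\<lambda>z. (F \<circ> cinv c) z * (F \<circ> cinv c) z) = Fsq F c"
        by (simp add: Fsq_def fun_eq_iff power2_eq_square)
      ultimately show "frechet_derivative l (at y) (\<xi> y) = 0"
        by (simp add: dl' field_deriv_def V_chart \<xi>_def)
      have "(local_rep V c has_derivative (\<lambda>w. (0, fst (frechet_derivative (local_rep H c) (at ?z) w)))) (at ?z)"
        unfolding V_chart
        by (intro has_derivative_Pair has_derivative_const has_derivative_fst smooth_on_has_derivative[OF h z])
      then have "frechet_derivative (local_rep V c) (at ?z) =
          (\<lambda>w. (0, fst (frechet_derivative (local_rep H c) (at ?z) w)))"
        by (rule frechet_derivative_at[symmetric])
      \<comment> \<open>The first component of \<open>[H,V] = S + S(I) V\<close>: \<open>V\<close> is vertical and \<open>S = (y, - 2 G)\<close>.\<close>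
      then have "- fst (frechet_derivative (local_rep H c) (at ?z) (0, \<xi> y)) = y"
        using arg_cong[OF bracket[OF c z], of fst] I0[OF u] S_chart[OF c z]
        by (simp add: field_bracket_def V_chart \<xi>_def spray_comps_def)
      then show "frechet_derivative \<xi> (at y) (\<xi> y) = - y" unfolding d\<xi>' by (metis minus_minus)
    qed
    then obtain a :: "real^2^2" where a: "transpose a = a" "\<And>y. y \<noteq> 0 \<Longrightarrow> l y = y \<bullet> (a *v y)" by blast
    have "(F (p, v))\<^sup>2 = v c0 \<bullet> (a *v v c0)" if v: "v \<in> tangent_space A p" for v
    proof (cases "v c0 = 0")
      case True
      then have v0: "v = (\<lambda>_. 0)"
        using base.tangent_vector_eqI[OF v base.zero_in_tangent_space c0 p] by simp
      have "(p, v) \<in> tangent_bundle A" using v c0 p by (auto simp: tangent_bundle_def points_def)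
      then have "F (p, v) = 0" using F v0 by (auto simp: finsler_function_def)
      then show ?thesis using True by simp
    next
      case False
      then have "(p, v) \<in> slit A" using v c0 p by (auto simp: slit_def tangent_bundle_def points_def)
      then show ?thesis using a(2)[OF False] point(2)[of v] by (simp add: l_def Fsq_def)
    qed
    then show "\<exists>a::real^2^2. transpose a = a \<and> (\<forall>v\<in>tangent_space A p. (F (p, v))\<^sup>2 = v c0 \<bullet> (a *v v c0))"
      using a(1) by blast
  qed
qed

end
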